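(* Let $d\ge 1$ and let finitely many terms be given, indexed by $i$, where term $i$ is a finite nonempty list of vectors $\delta_{i,j}\in\mathbb{Z}^d$. Let $F:\mathbb{Z}^d\to\mathbb{Z}_{\ge 0}$ be defined by $F(0)=1$, $F(y)=0$ whenever $y\ne0$ cannot be written as a finite sum (with repetition) of the vectors $\delta_{i,j}$, and $F(x)=\max_i\sum_j F(x-\delta_{i,j})$ otherwise. Let $t\in\mathbb{Z}^d$, and let $(c,w)$ be the optimal solution (with $c$ finite) of the associated quasiconvex program. Then $F(n\,t)=\Omega\big(c^n\, n^{(1-d)/2}\big)$ as $n\to\infty$.
   Context: For $v\in\mathbb{R}^d$ and term $i$: $c_{v,i}=+\infty$ if $v\cdot\delta_{i,j}\le0$ for some $j$, otherwise $c_{v,i}$ is the unique positive root of $r_{v,i}(c)=1-\sum_j c^{-v\cdot\delta_{i,j}}$; set $c_v=\max_i c_{v,i}$. The optimal solution $(c,w)$ of the quasiconvex program is the lexicographically smallest (first by $\lambda$, then by coordinates of $v$) pair $(\lambda,v)$ with $v\cdot t=1$ and $v$ lying, for every term $i$, in the closure of the level set $\{u: c_{u,i}\le\lambda\}$; thus $c=\inf\{c_v: v\cdot t=1\}$ and $w\cdot t=1$.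
   Formalization: The bound is for large n with nt a finite sum of the δ's (infinitely many if c>1): for all large n it fails (d=1, t=1, one term 2,2: F(odd)=0). c=inf{c_v: v·t=1} is assumed; it can fail only where the recursion for F is cyclic (terms [b],[-b]). *)

theory Defs
  imports "HOL-Analysis.Analysis" "HOL-Library.Landau_Symbols"
begin

text \<open>
  The family of terms is a list, and each term is the list of its \<open>\<delta>\<close>-vectors, so that a vector
  may occur several times in a term.
\<close>

definition real_vec :: "int ^ 'd \<Rightarrow> real ^ 'd" where
  "real_vec x = (\<chi> k. real_of_int (x $ k))"

definition reachable :: "(int ^ 'd) list list \<Rightarrow> int ^ 'd \<Rightarrow> bool" where
  "reachable terms y \<longleftrightarrow>
     (\<exists>xs. set xs \<subseteq> (\<Union>D\<in>set terms. set D) \<and> y = sum_list xs)"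

definition satisfies_recurrence :: "(int ^ 'd) list list \<Rightarrow> (int ^ 'd \<Rightarrow> nat) \<Rightarrow> bool" where
  "satisfies_recurrence terms F \<longleftrightarrow>
     F 0 = 1 \<and>
     (\<forall>y. y \<noteq> 0 \<and> \<not> reachable terms y \<longrightarrow> F y = 0) \<and>
     (\<forall>x. x \<noteq> 0 \<and> reachable terms x \<longrightarrow>
        F x = Max ((\<lambda>D. \<Sum>\<delta>\<leftarrow>D. F (x - \<delta>)) ` set terms))"

definition r_fun :: "real ^ 'd \<Rightarrow> (int ^ 'd) list \<Rightarrow> real \<Rightarrow> real" where
  "r_fun v D c = 1 - (\<Sum>\<delta>\<leftarrow>D. c powr (- (v \<bullet> real_vec \<delta>)))"

definition term_value :: "real ^ 'd \<Rightarrow> (int ^ 'd) list \<Rightarrow> ereal" where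
  "term_value v D =
     (if \<exists>\<delta>\<in>set D. v \<bullet> real_vec \<delta> \<le> 0 then \<infinity>
      else ereal (THE c. c > 0 \<and> r_fun v D c = 0))"

definition weight_value :: "(int ^ 'd) list list \<Rightarrow> real ^ 'd \<Rightarrow> ereal" where
  "weight_value terms v = Max (term_value v ` set terms)"

definition lex_less ::
    "real ^ 'd::{finite,linorder} \<Rightarrow> real ^ 'd::{finite,linorder} \<Rightarrow> bool" where
  "lex_less u v \<longleftrightarrow> (\<exists>k. u $ k < v $ k \<and> (\<forall>j<k. u $ j = v $ j))"

definition feasible :: "(int ^ 'd) list list \<Rightarrow> int ^ 'd \<Rightarrow> real \<Rightarrow> real ^ 'd \<Rightarrow> bool" where
  "feasible terms t l v \<longleftrightarrow>
     v \<bullet> real_vec t = 1 \<and>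
     (\<forall>D\<in>set terms. v \<in> closure {u. term_value u D \<le> ereal l})"

definition optimal_solution ::
    "(int ^ 'd::{finite,linorder}) list list \<Rightarrow> int ^ 'd::{finite,linorder} \<Rightarrow>
     real \<Rightarrow> real ^ 'd::{finite,linorder} \<Rightarrow> bool" where
  "optimal_solution terms t c w \<longleftrightarrow>
     feasible terms t c w \<and>
     (\<forall>l v. feasible terms t l v \<longrightarrow> c < l \<or> c = l \<and> (w = v \<or> lex_less w v))"

text \<open>
  \<open>F (n t)\<close> is \<open>0\<close> by definition whenever \<open>n t\<close> is a nonzero unreachable vector, e.g.
  for every odd \<open>n\<close> if \<open>d = 1\<close>, \<open>t = 1\<close> and the only term is \<open>[2, 2]\<close>. Asymptotic lower
  bounds are therefore taken along the following filter, which is \<open>sequentially\<close> itself as soon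
  as \<open>t\<close> is reachable.
\<close>

definition reachable_multiples :: "(int ^ 'd) list list \<Rightarrow> int ^ 'd \<Rightarrow> nat filter" where
  "reachable_multiples terms t =
     inf sequentially (principal {n. reachable terms (int n *s t)})"

lemma reachable_multiples_eq_sequentially:
  assumes "reachable terms t"
  shows "reachable_multiples terms t = sequentially"
proof -
  have "reachable terms (int n *s t)" for n
  proof (induction n)
    case 0
    show ?case unfolding reachable_def by (rule exI[of _ "[]"]) simp
  next
    case (Suc n)
    from Suc obtain xs where xs: "set xs \<subseteq> (\<Union>D\<in>set terms. set D)" "int n *s t = sum_list xs"
      unfolding reachable_def by blast
    from assms obtain ys where ys: "set ys \<subseteq> (\<Union>D\<in>set terms. set D)" "t = sum_list ys"
      unfolding reachable_def by blast
    have "int (Suc n) *s t = sum_list (ys @ xs)"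
      using xs(2) ys(2) by (simp add: vec_eq_iff algebra_simps)
    with xs(1) ys(1) show ?case
      unfolding reachable_def by (intro exI[of _ "ys @ xs"]) auto
  qed
  then show ?thesis
    by (simp add: reachable_multiples_def)
qed

end

theory Submission
  imports Defs
begin

text \<open>
  Let \<open>x\<^sub>0 = ln c *\<^sub>R w\<close>. Optimality makes \<open>x\<^sub>0\<close> a minimiser of the linear form \<open>x \<bullet> t\<close> under the
  convex constraints \<open>(\<Sum>\<delta>\<leftarrow>D. exp (- (x \<bullet> \<delta>))) \<le> 1\<close>, so by Karush-Kuhn-Tucker \<open>t\<close> is a positive
  combination of the mean steps of the tight terms, where in a tight term the step \<open>\<delta>\<close> has
  probability \<open>exp (- (x\<^sub>0 \<bullet> \<delta>))\<close>. A path from \<open>n t\<close> to \<open>0\<close> has probability \<open>c\<^sup>-\<^sup>n\<close>, and \<open>F (n t)\<close> is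
  at least the number of paths that follow any one schedule of terms. Take a schedule that uses
  every tight term but one a fixed number of times and then repeats the last one. The
  multiplicities of the steps may vary by \<open>\<surd>n\<close> around their means inside a lattice of corank at
  most \<open>I - 1 + d\<close>, for \<open>I\<close> tight terms with \<open>J\<close> steps in total; by pigeonhole this leaves of the
  order of \<open>n powr ((J - I + 1 - d) / 2)\<close> choices, each of multinomial probability at least of the
  order of \<open>n powr (- (J - I) / 2)\<close>.
\<close>

subsection \<open>Multinomial probabilities near the mean\<close>

text \<open>By induction the increment reduces to
  \<open>(n + 1/2) * (ln (n + 1) - ln n) \<ge> 1\<close>, the midpoint lower bound for the integral
  of \<open>1 / x\<close> over \<open>[n, n + 1]\<close>.\<close>

lemma stirling_upper:
  assumes "n \<ge> 1"
  shows "ln (fact n :: real) \<le> (real n + 1/2) * ln (real n) - real n + 1"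
  using assms
proof (induction n rule: dec_induct)
  case base
  then show ?case by simp
next
  case (step n)
  have "1 \<le> (real n + 1/2) * (ln (real n + 1) - ln (real n))"
  proof -
    have "2 / (2 * real n + 1) \<le> ln (real n + 1) - ln (real n)"
      using ln_inverse_approx_ge[of "real n" "real n + 1"] step.hyps by simp
    then have "(real n + 1/2) * (2 / (2 * real n + 1)) \<le> (real n + 1/2) * (ln (real n + 1) - ln (real n))"
      by (intro mult_left_mono) auto
    moreover have "(real n + 1/2) * (2 / (2 * real n + 1)) = 1"
      by (simp add: field_simps)
    ultimately show ?thesis by metis
  qed
  moreover have "ln (fact (Suc n) :: real) = ln (real n + 1) + ln (fact n)"
    by (simp add: ln_mult add.commute)
  ultimately show ?case
    using step.IH by (simp add: algebra_simps)
qed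

text \<open>The trapezoidal upper bound for the same integral leaves the error
  \<open>1 / (4 * n) - 1 / (4 * (n + 1))\<close>, which telescopes. The induction therefore carries
  the extra summand \<open>1 / (4 * n)\<close>; the constant \<open>3/4\<close> gives equality at
  \<open>n = 1\<close>.\<close>

lemma stirling_lower:
  assumes "n \<ge> 1"
  shows "ln (fact n :: real) \<ge> (real n + 1/2) * ln (real n) - real n + 3/4"
proof -
  have "ln (fact n :: real) \<ge> (real n + 1/2) * ln (real n) - real n + 3/4 + 1 / (4 * real n)"
    using assms
  proof (induction n rule: dec_induct)
    case base
    then show ?case by simp
  next
    case (step n)
    have pos: "real n > 0" using step.hyps by simp
    have "(real n + 1/2) * (ln (real n + 1) - ln (real n))
      \<le> (real n + 1/2) * ((inverse (real n) + inverse (real n + 1)) / 2)"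
      using ln_inverse_approx_le[of "real n" 1] pos by (intro mult_left_mono) auto
    also have "\<dots> = 1 + 1 / (4 * real n) - 1 / (4 * real (Suc n))"
      using pos by (simp add: divide_simps) (simp add: algebra_simps)
    finally have "(real n + 1/2) * (ln (real n + 1) - ln (real n))
      \<le> 1 + 1 / (4 * real n) - 1 / (4 * real (Suc n))" .
    moreover have "ln (fact (Suc n) :: real) = ln (real n + 1) + ln (fact n)"
      by (simp add: ln_mult add.commute)
    ultimately show ?case
      using step.IH by (simp add: algebra_simps)
  qed
  then show ?thesis
    by (smt (verit) divide_nonneg_nonneg of_nat_0_le_iff)
qed

text \<open>Only the relative entropy of the empirical frequencies with respect to \<open>p\<close> matters, and it
  is bounded by a chi-square distance.\<close>

lemma multinomial_weight_lower:
  fixes p :: "nat \<Rightarrow> real" and C \<alpha> :: real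
  assumes k: "k \<ge> 1" and p: "\<And>j. j < k \<Longrightarrow> p j > 0" and p1: "(\<Sum>j<k. p j) = 1"
    and \<alpha>: "\<alpha> > 0" and C: "C \<ge> 0"
  shows "\<exists>\<kappa>>0. \<forall>n\<ge>1. \<forall>m. (\<forall>j<k. m j \<ge> 1 \<and> \<bar>real (m j) - real n * \<alpha> * p j\<bar> \<le> C * sqrt (real n))
    \<longrightarrow> \<kappa> * real n powr (- ((real k - 1) / 2))
        \<le> fact (\<Sum>j<k. m j) / (\<Prod>j<k. fact (m j)) * (\<Prod>j<k. p j ^ m j)"
proof -
  \<comment> \<open>\<open>E\<close> will bound the chi-square terms and \<open>R\<close> the ratio
    \<open>N / n\<close>; \<open>\<kappa>\<close> collects what remains after taking logarithms,
    with \<open>3/4\<close> and \<open>k\<close> coming from the two Stirling bounds.\<close>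
  define E where "E = (\<Sum>j<k. C\<^sup>2 / (\<alpha> * p j))"
  define R where "R = \<alpha> + real k * C"
  define \<kappa> where "\<kappa> = exp (3/4 - real k - E - (real k - 1) / 2 * ln R)"
  have "\<kappa> * real n powr (- ((real k - 1) / 2))
        \<le> fact (\<Sum>j<k. m j) / (\<Prod>j<k. fact (m j)) * (\<Prod>j<k. p j ^ m j)"
    if n: "n \<ge> 1" and m1: "\<And>j. j < k \<Longrightarrow> m j \<ge> 1"
      and dev: "\<And>j. j < k \<Longrightarrow> \<bar>real (m j) - real n * \<alpha> * p j\<bar> \<le> C * sqrt (real n)" for n m
  proof -
    define N where "N = (\<Sum>j<k. m j)"
    define q where "q j = real n * \<alpha> * p j" for j
    have Npos: "N \<ge> 1"
    proof -
      have "m 0 \<le> N" unfolding N_def using k by (intro member_le_sum) auto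
      with m1[of 0] k show ?thesis by simp
    qed
    have q: "q j > 0" if "j < k" for j using n \<alpha> p[OF that] by (simp add: q_def)
    have pne: "p j \<noteq> 0" if "j < k" for j using p[OF that] by simp
    have sumq: "(\<Sum>j<k. q j) = real n * \<alpha>"
      unfolding q_def by (simp flip: sum_distrib_left add: p1)
    have mN: "m j \<le> N" if "j < k" for j
      unfolding N_def using that by (intro member_le_sum) auto
    have NR: "real N \<le> R * real n"
    proof -
      have "real N - real n * \<alpha> = (\<Sum>j<k. real (m j) - q j)"
        by (simp add: sum_subtractf sumq N_def)
      also have "\<dots> \<le> (\<Sum>j<k. C * sqrt (real n))"
        using dev by (intro sum_mono) (auto simp: q_def abs_le_iff)
      also have "\<dots> = real k * C * sqrt (real n)" by simp
      also have "\<dots> \<le> real k * C * real n"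
        using n C by (intro mult_left_mono) (auto intro!: real_le_lsqrt simp: power2_eq_square)
      finally show ?thesis by (simp add: R_def algebra_simps)
    qed
    have Rpos: "R > 0" using \<alpha> C by (simp add: R_def add_pos_nonneg)
    have entropy: "(\<Sum>j<k. real (m j) * (ln (m j) - ln (p j))) \<le> real N * ln N + E"
    proof -
      \<comment> \<open>The inequality \<open>ln x \<le> x - 1\<close> at
        \<open>x = m j / q j\<close> leaves a quadratic part, controlled by the deviation bound, and
        a linear part whose sum over \<open>j\<close> is \<open>N - n * \<alpha>\<close>.\<close>
      have one: "real (m j) * (ln (m j) - ln (q j)) \<le> C\<^sup>2 / (\<alpha> * p j) + (real (m j) - q j)" if j: "j < k" for j
      proof -
        have "ln (m j) - ln (q j) = ln (real (m j) / q j)"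
          using m1[OF j] q[OF j] by (simp add: ln_div)
        also have "\<dots> \<le> real (m j) / q j - 1"
          using m1[OF j] q[OF j] by (intro ln_le_minus_one) auto
        finally have "real (m j) * (ln (m j) - ln (q j)) \<le> real (m j) * (real (m j) / q j - 1)"
          by (intro mult_left_mono) auto
        also have "\<dots> = (real (m j) - q j)\<^sup>2 / q j + (real (m j) - q j)"
          using q[OF j] by (simp add: field_simps power2_eq_square)
        also have "(real (m j) - q j)\<^sup>2 / q j \<le> (C * sqrt n)\<^sup>2 / q j"
        proof -
          have "(real (m j) - q j)\<^sup>2 \<le> (C * sqrt n)\<^sup>2"
            using dev[OF j] unfolding q_def by (metis power2_abs power_mono abs_ge_zero)
          with q[OF j] show ?thesis by (intro divide_right_mono) auto
        qed
        also have "(C * sqrt n)\<^sup>2 / q j = C\<^sup>2 / (\<alpha> * p j)"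
          using n by (simp add: q_def power_mult_distrib)
        finally show ?thesis by simp
      qed
      have "(\<Sum>j<k. real (m j) * (ln (m j) - ln (q j))) \<le> (\<Sum>j<k. C\<^sup>2 / (\<alpha> * p j) + (real (m j) - q j))"
        using one by (intro sum_mono) auto
      also have "\<dots> = E + (real N - real n * \<alpha>)"
        by (simp add: sum.distrib sum_subtractf sumq E_def N_def)
      \<comment> \<open>The same inequality at \<open>n * \<alpha> / N\<close> turns the linear part
        into logarithms, and \<open>ln (n * \<alpha>)\<close> cancels when \<open>q\<close> is
        replaced by \<open>p\<close>.\<close>
      also have "real N - real n * \<alpha> \<le> real N * (ln N - ln (real n * \<alpha>))"
      proof -
        have "ln (real n * \<alpha>) - ln N = ln (real n * \<alpha> / N)"
          using n \<alpha> Npos by (simp add: ln_div)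
        also have "\<dots> \<le> real n * \<alpha> / N - 1"
          using n \<alpha> Npos by (intro ln_le_minus_one) auto
        finally have "real N * (ln (real n * \<alpha>) - ln N) \<le> real N * (real n * \<alpha> / N - 1)"
          by (intro mult_left_mono) auto
        also have "\<dots> = real n * \<alpha> - real N" using Npos by (simp add: field_simps)
        finally show ?thesis by (simp add: algebra_simps)
      qed
      finally have *: "(\<Sum>j<k. real (m j) * (ln (m j) - ln (q j)))
          \<le> E + real N * (ln N - ln (real n * \<alpha>))" by simp
      have "(\<Sum>j<k. real (m j) * (ln (m j) - ln (q j)))
        = (\<Sum>j<k. real (m j) * (ln (m j) - ln (p j)) - real (m j) * ln (real n * \<alpha>))"
        using n \<alpha> p pne by (intro sum.cong) (auto simp: q_def ln_mult algebra_simps)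
      also have "\<dots> = (\<Sum>j<k. real (m j) * (ln (m j) - ln (p j))) - real N * ln (real n * \<alpha>)"
        by (simp add: sum_subtractf N_def sum_distrib_right)
      finally show ?thesis using * by (simp add: algebra_simps)
    qed
    \<comment> \<open>These are the square-root factors of Stirling's formula: \<open>k\<close> in
      the denominator and one in the numerator, with all arguments at most \<open>R * n\<close>.
      They produce the exponent \<open>(k - 1) / 2\<close>.\<close>
    have half: "(\<Sum>j<k. 1/2 * ln (m j)) - 1/2 * ln N \<le> (real k - 1) / 2 * (ln R + ln n)"
    proof -
      have "(\<Sum>j<k. 1/2 * ln (m j)) \<le> (\<Sum>j<k. 1/2 * ln N)"
        using mN m1 Npos by (intro sum_mono mult_left_mono) (auto simp: Suc_le_eq)
      also have "\<dots> = real k / 2 * ln N" by simp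
      finally have "(\<Sum>j<k. 1/2 * ln (m j)) - 1/2 * ln N \<le> (real k - 1) / 2 * ln N"
        by (simp add: algebra_simps diff_divide_distrib)
      also have "ln N \<le> ln (R * n)"
        using NR Npos Rpos n by (subst ln_le_cancel_iff) auto
      also have "ln (R * n) = ln R + ln n"
        using Rpos n by (simp add: ln_mult)
      finally show ?thesis using k by (simp add: mult_left_mono)
    qed
    define P where "P = fact N / (\<Prod>j<k. fact (m j)) * (\<Prod>j<k. p j ^ m j)"
    have Ppos: "P > 0"
      unfolding P_def using p by (auto intro!: mult_pos_pos divide_pos_pos prod_pos)
    have "ln P = ln (fact N) - (\<Sum>j<k. ln (fact (m j))) + (\<Sum>j<k. real (m j) * ln (p j))"
    proof -
      have "ln P = ln (fact N) - ln (\<Prod>j<k. fact (m j) :: real) + ln (\<Prod>j<k. p j ^ m j)"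
        unfolding P_def using p pne
        by (subst ln_mult) (auto intro!: divide_pos_pos prod_pos simp: ln_div prod_pos)
      also have "ln (\<Prod>j<k. fact (m j) :: real) = (\<Sum>j<k. ln (fact (m j)))"
        by (subst ln_prod) auto
      also have "ln (\<Prod>j<k. p j ^ m j) = (\<Sum>j<k. real (m j) * ln (p j))"
        using p pne by (subst ln_prod) (auto simp: ln_realpow intro!: sum.cong)
      finally show ?thesis .
    qed
    moreover have "(\<Sum>j<k. ln (fact (m j) :: real)) \<le> (\<Sum>j<k. (real (m j) + 1/2) * ln (m j) - real (m j) + 1)"
      using m1 stirling_upper by (intro sum_mono) auto
    moreover have "(\<Sum>j<k. (real (m j) + 1/2) * ln (m j) - real (m j) + 1)
      = (\<Sum>j<k. real (m j) * ln (m j)) + (\<Sum>j<k. 1/2 * ln (m j)) - real N + real k"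
      by (simp add: sum.distrib sum_subtractf N_def algebra_simps)
    moreover have "(\<Sum>j<k. real (m j) * (ln (m j) - ln (p j)))
      = (\<Sum>j<k. real (m j) * ln (m j)) - (\<Sum>j<k. real (m j) * ln (p j))"
      by (simp add: right_diff_distrib sum_subtractf)
    ultimately have "ln P \<ge> 3/4 - real k - E - (real k - 1) / 2 * (ln R + ln n)"
      using stirling_lower[OF Npos] entropy half by (simp add: distrib_right)
    moreover have "ln (\<kappa> * real n powr (- ((real k - 1) / 2))) = 3/4 - real k - E - (real k - 1) / 2 * (ln R + ln n)"
      using n by (simp add: ln_mult \<kappa>_def ln_powr distrib_left)
    ultimately have "ln (\<kappa> * real n powr (- ((real k - 1) / 2))) \<le> ln P" by simp
    moreover have "\<kappa> * real n powr (- ((real k - 1) / 2)) > 0" using n by (simp add: \<kappa>_def)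
    ultimately show ?thesis
      using Ppos unfolding P_def N_def by (subst (asm) ln_le_cancel_iff) auto
  qed
  moreover have "\<kappa> > 0" by (simp add: \<kappa>_def)
  ultimately show ?thesis by blast
qed

subsection \<open>Lagrange multipliers\<close>

text \<open>If \<open>0\<close> lay outside the hull of \<open>- t\<close> and the mean steps of the
  tight terms, a short move along the normal of a separating hyperplane would be strictly feasible
  with a smaller objective. The vector \<open>v0\<close>, positive on every step, rules out a zero
  multiplier for \<open>t\<close>.\<close>

lemma kkt_multipliers:
  fixes \<delta> :: "'t \<Rightarrow> nat \<Rightarrow> 'a::euclidean_space" and k :: "'t \<Rightarrow> nat"
  defines "g \<equiv> \<lambda>x D. \<Sum>j<k D. exp (- (x \<bullet> \<delta> D j))"
  assumes fin: "finite T" and k: "\<And>D. D \<in> T \<Longrightarrow> k D \<ge> 1"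
    and v0: "\<And>D j. D \<in> T \<Longrightarrow> j < k D \<Longrightarrow> v0 \<bullet> \<delta> D j > 0"
    and x0: "\<And>D. D \<in> T \<Longrightarrow> g x0 D \<le> 1" and t: "x0 \<bullet> t > 0"
    and opt: "\<And>x. (\<And>D. D \<in> T \<Longrightarrow> g x D < 1) \<Longrightarrow> x \<bullet> t > 0 \<Longrightarrow> x0 \<bullet> t \<le> x \<bullet> t"
  shows "\<exists>A \<alpha>. A \<subseteq> T \<and> A \<noteq> {} \<and> (\<forall>D\<in>A. \<alpha> D > 0 \<and> g x0 D = 1) \<and>
    t = (\<Sum>D\<in>A. \<alpha> D *\<^sub>R (\<Sum>j<k D. exp (- (x0 \<bullet> \<delta> D j)) *\<^sub>R \<delta> D j))"
proof -
  define \<mu> where "\<mu> D = (\<Sum>j<k D. exp (- (x0 \<bullet> \<delta> D j)) *\<^sub>R \<delta> D j)" for D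
  define T0 where "T0 = {D\<in>T. g x0 D = 1}"
  have finT0: "finite T0" and T0T: "T0 \<subseteq> T" using fin by (auto simp: T0_def)
  have v0\<mu>: "v0 \<bullet> \<mu> D > 0" if "D \<in> T" for D
    unfolding \<mu>_def inner_sum_right using v0[OF that] k[OF that]
    by (intro sum_pos) (auto simp: Suc_le_eq)
  have "0 \<in> convex hull (insert (- t) (\<mu> ` T0))"
  proof (rule ccontr)
    assume "0 \<notin> convex hull (insert (- t) (\<mu> ` T0))"
    moreover have "closed (convex hull (insert (- t) (\<mu> ` T0)))"
      using finT0 by (intro compact_imp_closed finite_imp_compact_convex_hull) auto
    ultimately obtain y b where b: "b > 0" and y: "\<And>x. x \<in> convex hull (insert (- t) (\<mu> ` T0)) \<Longrightarrow> y \<bullet> x > b"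
      using separating_hyperplane_closed_0[OF convex_convex_hull] by blast
    have yt: "y \<bullet> t < 0" using y[of "- t"] b by (auto simp: hull_inc)
    have y\<mu>: "y \<bullet> \<mu> D > 0" if "D \<in> T0" for D
      using y[of "\<mu> D"] b that by (auto simp: hull_inc)
    \<comment> \<open>A tight constraint falls to first order, its derivative along \<open>y\<close>
      being \<open>- (y \<bullet> \<mu> D) < 0\<close>; a slack one stays slack by
      continuity.\<close>
    have ev1: "\<forall>\<^sub>F h in at_right 0. g (x0 + h *\<^sub>R y) D < 1" if D: "D \<in> T" for D
    proof (cases "D \<in> T0")
      case True
      have "((\<lambda>h. g (x0 + h *\<^sub>R y) D) has_real_derivative - (y \<bullet> \<mu> D)) (at 0)"
        unfolding g_def \<mu>_def
        by (auto intro!: derivative_eq_intros simp: inner_sum_right sum_negf algebra_simps inner_add_left)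
      from DERIV_neg_dec_right[OF this] y\<mu>[OF True] obtain e where e: "e > 0"
        "\<And>h. h > 0 \<Longrightarrow> h < e \<Longrightarrow> g x0 D > g (x0 + h *\<^sub>R y) D" by auto
      moreover have "g x0 D = 1" using True by (simp add: T0_def)
      ultimately show ?thesis unfolding eventually_at_right_field by (intro exI[of _ e]) auto
    next
      case False
      then have lt: "g x0 D < 1" using x0[OF D] D by (force simp: T0_def)
      have "((\<lambda>h. g (x0 + h *\<^sub>R y) D) \<longlongrightarrow> g (x0 + 0 *\<^sub>R y) D) (at_right 0)"
        unfolding g_def by (intro tendsto_intros)
      then show ?thesis using lt by (intro order_tendstoD(2)[of _ "g x0 D"]) auto
    qed
    have "((\<lambda>h. (x0 + h *\<^sub>R y) \<bullet> t) \<longlongrightarrow> (x0 + 0 *\<^sub>R y) \<bullet> t) (at_right 0)"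
      by (intro tendsto_intros)
    then have ev2: "\<forall>\<^sub>F h in at_right 0. (x0 + h *\<^sub>R y) \<bullet> t > 0"
      using t by (intro order_tendstoD(1)[of _ "x0 \<bullet> t"]) auto
    have ev3: "\<forall>\<^sub>F h::real in at_right 0. h > 0"
      by (rule eventually_at_right_less)
    have "\<forall>\<^sub>F h in at_right 0. \<forall>D\<in>T. g (x0 + h *\<^sub>R y) D < 1"
      using fin ev1 by (simp add: eventually_ball_finite)
    with ev2 ev3 have "\<forall>\<^sub>F h::real in at_right 0. False"
    proof eventually_elim
      case (elim h)
      then have "x0 \<bullet> t \<le> (x0 + h *\<^sub>R y) \<bullet> t" using opt by blast
      then show ?case using yt elim by (simp add: inner_add_left mult_pos_neg not_le zero_le_mult_iff)
    qed
    then show False by simp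
  qed
  then obtain u where u: "\<And>x. x \<in> insert (- t) (\<mu> ` T0) \<Longrightarrow> u x \<ge> 0"
      and u1: "sum u (insert (- t) (\<mu> ` T0)) = 1"
      and u0: "(\<Sum>x\<in>insert (- t) (\<mu> ` T0). u x *\<^sub>R x) = 0"
    using finT0 by (subst (asm) convex_hull_finite) auto
  \<comment> \<open>The hull is that of a set, so \<open>- t\<close> may coincide with a mean step;
    \<open>M\<close> keeps the points of positive weight other than \<open>- t\<close>.\<close>
  define M where "M = {x \<in> insert (-t) (\<mu> ` T0). x \<noteq> - t \<and> u x > 0}"
  have finM: "finite M" using finT0 by (simp add: M_def)
  have M: "M \<subseteq> \<mu> ` T0" by (auto simp: M_def)
  have split: "(\<Sum>x\<in>insert (- t) (\<mu> ` T0). u x *\<^sub>R x) = u (- t) *\<^sub>R (- t) + (\<Sum>x\<in>M. u x *\<^sub>R x)"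
  proof -
    have "u x = 0" if "x \<in> insert (- t) (\<mu> ` T0) - insert (- t) M" for x
      using u[of x] that by (force simp: M_def)
    then have "(\<Sum>x\<in>insert (- t) (\<mu> ` T0). u x *\<^sub>R x) = (\<Sum>x\<in>insert (-t) M. u x *\<^sub>R x)"
      using finT0 by (intro sum.mono_neutral_right) (auto simp: M_def)
    also have "\<dots> = u (- t) *\<^sub>R (- t) + (\<Sum>x\<in>M. u x *\<^sub>R x)"
      using finM by (subst sum.insert) (auto simp: M_def)
    finally show ?thesis .
  qed
  then have eq: "u (- t) *\<^sub>R t = (\<Sum>x\<in>M. u x *\<^sub>R x)" using u0 by (simp add: algebra_simps)
  have upos: "u x > 0" if "x \<in> M" for x using that by (simp add: M_def)
  have v0M: "v0 \<bullet> x > 0" if "x \<in> M" for x using that M v0\<mu> T0T by auto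
  have M0: "M \<noteq> {}"
  proof
    assume M0: "M = {}"
    have "t \<noteq> 0" using t by auto
    with M0 eq have "u (- t) = 0" by simp
    moreover have "u x = 0" if "x \<in> insert (- t) (\<mu> ` T0)" "x \<noteq> - t" for x
    proof -
      have "x \<notin> M" using M0 by simp
      with u[OF that(1)] that show ?thesis by (auto simp: M_def)
    qed
    ultimately have "sum u (insert (- t) (\<mu> ` T0)) = 0" by (intro sum.neutral) metis
    with u1 show False by simp
  qed
  \<comment> \<open>With weight \<open>0\<close> at \<open>- t\<close>, a positive combination of
    mean steps would vanish, although \<open>v0\<close> is positive on each of them.\<close>
  have ut: "u (- t) > 0"
  proof (rule ccontr)
    assume "\<not> u (- t) > 0"
    with u[of "- t"] have "u (- t) = 0" by simp
    then have "v0 \<bullet> (\<Sum>x\<in>M. u x *\<^sub>R x) = 0" using eq by simp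
    moreover have "v0 \<bullet> (\<Sum>x\<in>M. u x *\<^sub>R x) > 0"
      unfolding inner_sum_right using finM M0 upos v0M by (intro sum_pos) auto
    ultimately show False by simp
  qed
  \<comment> \<open>Several terms may share a mean step; \<open>A\<close> picks one term for each
    point of \<open>M\<close>, so that the sum can be reindexed.\<close>
  obtain A where A: "A \<subseteq> T0" "inj_on \<mu> A" "M = \<mu> ` A"
    using M by (auto simp: subset_image_inj)
  have "t = (1 / u (- t)) *\<^sub>R (u (- t) *\<^sub>R t)" using ut by simp
  also have "\<dots> = (\<Sum>x\<in>M. (u x / u (- t)) *\<^sub>R x)"
    unfolding eq by (simp add: scaleR_sum_right)
  also have "\<dots> = (\<Sum>D\<in>A. (u (\<mu> D) / u (- t)) *\<^sub>R \<mu> D)"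
    unfolding A(3) by (subst sum.reindex[OF A(2)]) simp
  finally have "t = (\<Sum>D\<in>A. (u (\<mu> D) / u (- t)) *\<^sub>R \<mu> D)" .
  moreover have "\<forall>D\<in>A. u (\<mu> D) / u (- t) > 0 \<and> g x0 D = 1"
    using A upos ut by (auto simp: T0_def)
  ultimately show ?thesis
    using A M0 T0T unfolding \<mu>_def by (intro exI[of _ A] exI[of _ "\<lambda>D. u (\<mu> D) / u (- t)"]) (auto simp: \<mu>_def)
qed

subsection \<open>Counting paths\<close>

text \<open>A slot is one occurrence of a step in a term, and the step of slot \<open>i\<close> is
  \<open>fst i ! snd i\<close>. Counting by slots instead of vectors keeps repeated vectors apart,
  as the recurrence does.\<close>

definition slots :: "'a list set \<Rightarrow> ('a list \<times> nat) set" where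
  "slots A = Sigma A (\<lambda>D. {..<length D})"

definition displacement :: "((int ^ 'd) list \<times> nat) set \<Rightarrow> ((int ^ 'd) list \<times> nat \<Rightarrow> int) \<Rightarrow> int ^ 'd" where
  "displacement I z = (\<Sum>i\<in>I. z i *s (fst i ! snd i))"

definition term_size :: "('a list \<times> nat \<Rightarrow> nat) \<Rightarrow> 'a list \<Rightarrow> nat" where
  "term_size m D = (\<Sum>j<length D. m (D, j))"

text \<open>The number of ways to fill a fixed schedule of terms with steps so that slot
  \<open>i\<close> is used \<open>m i\<close> times: one multinomial coefficient for each
  term.\<close>

definition arrangements :: "'a list set \<Rightarrow> ('a list \<times> nat \<Rightarrow> nat) \<Rightarrow> real" where
  "arrangements A m =
     (\<Prod>D\<in>A. fact (term_size m D) / (\<Prod>j<length D. fact (m (D, j))))"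

lemma finite_slots [simp]: "finite A \<Longrightarrow> finite (slots A)"
  by (simp add: slots_def)

lemma sum_slots: "finite A \<Longrightarrow> (\<Sum>i\<in>slots A. f i) = (\<Sum>D\<in>A. \<Sum>j<length D. f (D, j))"
  unfolding slots_def by (simp add: sum.Sigma)

lemma prod_slots: "finite A \<Longrightarrow> (\<Prod>i\<in>slots A. f i) = (\<Prod>D\<in>A. \<Prod>j<length D. f (D, j))"
  unfolding slots_def by (simp add: prod.Sigma)

text \<open>Pascal's rule for multinomial coefficients, sorting the arrangements by the slot taken
  at one use of \<open>D\<close>. Lowering slot \<open>j\<close> multiplies the count by
  \<open>m (D, j) / N\<close>, and these fractions add up to \<open>1\<close>.\<close>

lemma arrangements_peel:
  assumes fin: "finite A" and D: "D \<in> A" and pos: "term_size m D > 0"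
  shows "(\<Sum>j | j < length D \<and> m (D, j) > 0. arrangements A (m((D, j) := m (D, j) - 1)))
    = arrangements A m"
proof -
  define X where "X D m = fact (term_size m D) / (\<Prod>j<length D. fact (m (D, j)) :: real)"
    for D and m :: "'a list \<times> nat \<Rightarrow> nat"
  define N where "N = term_size m D"
  have arr: "arrangements A m = X D m * (\<Prod>D\<in>A - {D}. X D m)" for m
    unfolding arrangements_def X_def by (rule prod.remove[OF fin D])
  have step: "arrangements A (m((D, j) := m (D, j) - 1)) = arrangements A m * (real (m (D, j)) / real N)"
    if j: "j < length D" "m (D, j) > 0" for j
  proof -
    define m' where "m' = m((D, j) := m (D, j) - 1)"
    have "term_size m D = m (D, j) + (\<Sum>j\<in>{..<length D} - {j}. m (D, j))"
      unfolding term_size_def using j by (subst sum.remove[of _ j]) auto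
    moreover have "term_size m' D = m (D, j) - 1 + (\<Sum>j\<in>{..<length D} - {j}. m (D, j))"
      unfolding term_size_def using j by (subst sum.remove[of _ j]) (auto simp: m'_def)
    ultimately have ts: "N = Suc (term_size m' D)" using j by (simp add: N_def)
    have p: "(\<Prod>j<length D. fact (m (D, j)) :: real)
      = fact (m (D, j)) * (\<Prod>j\<in>{..<length D} - {j}. fact (m (D, j)))"
      using j by (subst prod.remove[of _ j]) auto
    have p': "(\<Prod>j<length D. fact (m' (D, j)) :: real)
      = fact (m (D, j) - 1) * (\<Prod>j\<in>{..<length D} - {j}. fact (m (D, j)))"
      using j by (subst prod.remove[of _ j]) (auto simp: m'_def)
    have f: "(fact (m (D, j)) :: real) = real (m (D, j)) * fact (m (D, j) - 1)"
      using j by (simp add: fact_reduce)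
    have "X D m' = X D m * (real (m (D, j)) / real N)"
      unfolding X_def p p' f N_def[symmetric] unfolding ts using j
      by (simp add: field_simps del: of_nat_Suc)
    moreover have "X D' m' = X D' m" if "D' \<in> A - {D}" for D'
      using that by (auto simp: X_def m'_def term_size_def)
    ultimately show ?thesis
      unfolding arr m'_def[symmetric] by simp
  qed
  have "(\<Sum>j | j < length D \<and> m (D, j) > 0. real (m (D, j))) = (\<Sum>j<length D. real (m (D, j)))"
    by (rule sum.mono_neutral_left) auto
  also have "\<dots> = real N" by (simp add: N_def term_size_def)
  finally have "(\<Sum>j | j < length D \<and> m (D, j) > 0. real (m (D, j))) = real N" .
  note sum_eq = this
  have "(\<Sum>j | j < length D \<and> m (D, j) > 0. arrangements A (m((D, j) := m (D, j) - 1)))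
    = (\<Sum>j | j < length D \<and> m (D, j) > 0. arrangements A m * (real (m (D, j)) / real N))"
    using step by (intro sum.cong) auto
  also have "\<dots> = arrangements A m * ((\<Sum>j | j < length D \<and> m (D, j) > 0. real (m (D, j))) / real N)"
    by (simp only: sum_distrib_left sum_divide_distrib)
  also have "\<dots> = arrangements A m" unfolding sum_eq using pos by (simp add: N_def)
  finally show ?thesis .
qed

lemma displacement_decrement:
  assumes "finite I" "i \<in> I" "m i > 0"
  shows "displacement I (\<lambda>l. int ((m(i := m i - 1)) l)) = displacement I (\<lambda>l. int (m l)) - fst i ! snd i"
  unfolding displacement_def using assms
  by (subst (1 2) sum.remove[of _ i]) (auto simp: vec_eq_iff algebra_simps of_nat_diff)

text \<open>The terms of \<open>A - {E}\<close> are used a prescribed number of times, after which \<open>E\<close> is used until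
  the origin is hit. The number of uses of \<open>E\<close> is thus free, which gains the factor \<open>\<surd>n\<close>.\<close>

lemma sum_arrangements_le:
  fixes F :: "int ^ 'd \<Rightarrow> nat"
  assumes fin: "finite A" and E: "E \<in> A" and F0: "F 0 = 1"
    and super: "\<And>x D. D \<in> A \<Longrightarrow> (\<Sum>j<length D. F (x - D ! j)) \<le> F x"
    and pos: "\<And>D \<delta>. D \<in> A \<Longrightarrow> \<delta> \<in> set D \<Longrightarrow> v0 \<bullet> real_vec \<delta> > 0"
    and S: "finite S"
      "\<And>m i. m \<in> S \<Longrightarrow> i \<notin> slots A \<Longrightarrow> m i = 0"
      "\<And>m D. m \<in> S \<Longrightarrow> D \<in> A - {E} \<Longrightarrow> term_size m D = q D"
      "\<And>m. m \<in> S \<Longrightarrow> displacement (slots A) (\<lambda>i. int (m i)) = x"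
  shows "(\<Sum>m\<in>S. arrangements A m) \<le> real (F x)"
proof -
  \<comment> \<open>All steps are positive under \<open>v0\<close>, so only the empty path has
    displacement \<open>0\<close>.\<close>
  have displ0: "\<forall>i. m i = 0"
    if m: "\<And>i. i \<notin> slots A \<Longrightarrow> m i = 0" "displacement (slots A) (\<lambda>i. int (m i)) = 0" for m
  proof (rule ccontr)
    assume "\<not> (\<forall>i. m i = 0)"
    then obtain i where i: "m i > 0" by auto
    then have iA: "i \<in> slots A" using m(1)[of i] by (cases "i \<in> slots A") auto
    have st: "v0 \<bullet> real_vec (fst l ! snd l) > 0" if "l \<in> slots A" for l
      using that pos by (auto simp: slots_def)
    have "real_vec (displacement (slots A) (\<lambda>i. int (m i))) = (\<Sum>l\<in>slots A. real (m l) *\<^sub>R real_vec (fst l ! snd l))"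
      by (simp add: displacement_def real_vec_def vec_eq_iff)
    then have "0 = v0 \<bullet> (\<Sum>l\<in>slots A. real (m l) *\<^sub>R real_vec (fst l ! snd l))"
      using m(2) by (simp add: real_vec_def vec_eq_iff inner_vec_def)
    moreover have "v0 \<bullet> (\<Sum>l\<in>slots A. real (m l) *\<^sub>R real_vec (fst l ! snd l)) > 0"
      unfolding inner_sum_right using fin iA i st
      by (intro sum_pos2[of _ i]) (simp_all add: less_imp_le)
    ultimately show False by simp
  qed
  \<comment> \<open>\<open>N\<close> bounds the length of all paths counted by \<open>S\<close>. The
    induction runs on it, with \<open>S\<close>, \<open>q\<close> and \<open>x\<close>
    arbitrary.\<close>
  have "\<exists>N. \<forall>m\<in>S. (\<Sum>i\<in>slots A. m i) \<le> N"
    using S(1) by (intro exI[of _ "\<Sum>m\<in>S. \<Sum>i\<in>slots A. m i"]) (auto intro!: member_le_sum)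
  then obtain N where "\<And>m. m \<in> S \<Longrightarrow> (\<Sum>i\<in>slots A. m i) \<le> N" by blast
  with S show ?thesis
  proof (induction N arbitrary: S q x)
    case (0 S q x)
    have z: "m = (\<lambda>i. 0)" if "m \<in> S" for m
      using 0(2)[OF that] 0(5)[OF that] fin by (auto simp: fun_eq_iff) 
    show ?case
    proof (cases "S = {}")
      case False
      then have "S = {\<lambda>i. 0}" using z by auto
      moreover from this 0(4) have "x = 0" by (auto simp: displacement_def)
      ultimately show ?thesis by (simp add: F0 arrangements_def term_size_def)
    qed simp
  next
    case (Suc N S q x)
    show ?case
    proof (cases "x = 0")
      case True
      have "m = (\<lambda>i. 0)" if "m \<in> S" for m
        using displ0[of m] Suc.prems(2,4) that True by (auto simp: fun_eq_iff)
      then have "S \<subseteq> {\<lambda>i. 0}" by auto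
      then have "(\<Sum>m\<in>S. arrangements A m) \<le> (\<Sum>m\<in>{\<lambda>i. 0}. arrangements A m)"
        by (intro sum_mono2) (auto simp: arrangements_def term_size_def)
      then show ?thesis by (simp add: True F0 arrangements_def term_size_def)
    next
      case False
      \<comment> \<open>The next term must be the same for all of \<open>S\<close>. Any
        \<open>D\<close> other than \<open>E\<close> with \<open>q D > 0\<close> will do; if there
        is none, it is \<open>E\<close>, which every \<open>m\<close> still uses because
        \<open>x \<noteq> 0\<close>.\<close>
      have "\<exists>D\<in>A. (\<forall>m\<in>S. term_size m D > 0)"
      proof (cases "\<exists>D\<in>A - {E}. q D > 0")
        case True
        then obtain D where "D \<in> A - {E}" "q D > 0" by blast
        with Suc.prems(3) show ?thesis by (intro bexI[of _ D]) auto
      next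
        case q: False
        have "term_size m E > 0" if m: "m \<in> S" for m
        proof (rule ccontr)
          assume "\<not> term_size m E > 0"
          then have "term_size m D = 0" if "D \<in> A" for D
            using q Suc.prems(3)[OF m, of D] that by (cases "D = E") auto
          then have "m i = 0" if "i \<in> slots A" for i
            using that by (auto simp: slots_def term_size_def)
          then have "displacement (slots A) (\<lambda>i. int (m i)) = 0"
            by (auto simp: displacement_def intro!: sum.neutral)
          with Suc.prems(4)[OF m] \<open>x \<noteq> 0\<close> show False by simp
        qed
        with E show ?thesis by blast
      qed
      then obtain D where D: "D \<in> A" and tsD: "\<And>m. m \<in> S \<Longrightarrow> term_size m D > 0" by blast
      define dec where "dec j m = m((D, j) := m (D, j) - 1)" for j and m :: "(int ^ 'd) list \<times> nat \<Rightarrow> nat"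
      define S' where "S' j = {m \<in> S. m (D, j) > 0}" for j
      have "(\<Sum>m\<in>S. arrangements A m) = (\<Sum>m\<in>S. \<Sum>j | j < length D \<and> m (D, j) > 0. arrangements A (dec j m))"
        using arrangements_peel[OF fin D tsD] by (simp add: dec_def)
      also have "\<dots> = (\<Sum>m\<in>S. \<Sum>j<length D. if m (D, j) > 0 then arrangements A (dec j m) else 0)"
      proof (rule sum.cong)
        fix m :: "(int ^ 'd) list \<times> nat \<Rightarrow> nat"
        have "{j. j < length D \<and> m (D, j) > 0} = {j \<in> {..<length D}. m (D, j) > 0}" by auto
        then show "(\<Sum>j | j < length D \<and> m (D, j) > 0. arrangements A (dec j m))
          = (\<Sum>j<length D. if m (D, j) > 0 then arrangements A (dec j m) else 0)"
          by (simp only: sum.inter_filter[OF finite_lessThan])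
      qed simp
      also have "\<dots> = (\<Sum>j<length D. \<Sum>m\<in>S. if m (D, j) > 0 then arrangements A (dec j m) else 0)"
        by (rule sum.swap)
      also have "\<dots> = (\<Sum>j<length D. \<Sum>m\<in>S' j. arrangements A (dec j m))"
        using Suc.prems(1) unfolding S'_def by (intro sum.cong refl sum.inter_filter [symmetric])
      \<comment> \<open>Decrementing is injective on \<open>S' j\<close>, and its image is again an
        admissible family, with target \<open>x - D ! j\<close> and length bound \<open>N\<close>,
        so the induction hypothesis applies to each first step.\<close>
      also have "\<dots> \<le> (\<Sum>j<length D. real (F (x - D ! j)))"
      proof (intro sum_mono)
        fix j assume j: "j \<in> {..<length D}"
        then have slot: "(D, j) \<in> slots A" using D by (simp add: slots_def)
        have inj: "inj_on (dec j) (S' j)"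
        proof (rule inj_onI)
          fix m m' assume mm: "m \<in> S' j" "m' \<in> S' j" "dec j m = dec j m'"
          show "m = m'"
          proof
            fix i show "m i = m' i"
              using fun_cong[OF mm(3), of i] mm(1,2) by (cases "i = (D, j)") (auto simp: dec_def S'_def)
          qed
        qed
        have "(\<Sum>m\<in>S' j. arrangements A (dec j m)) = (\<Sum>m\<in>dec j ` S' j. arrangements A m)"
          by (simp add: sum.reindex[OF inj])
        also have "\<dots> \<le> real (F (x - D ! j))"
        proof (rule Suc.IH[of _ "q(D := q D - 1)"], goal_cases)
          case 1
          then show ?case using Suc.prems(1) by (simp add: S'_def)
        next
          case (2 m i)
          then obtain m0 where "m0 \<in> S" "m = dec j m0" by (auto simp: S'_def)
          with 2(2) Suc.prems(2)[of m0 i] show ?case by (cases "i = (D, j)") (simp_all add: dec_def)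
        next
          case (3 m D')
          then obtain m0 where m0: "m0 \<in> S" "m0 (D, j) > 0" "m = dec j m0" by (auto simp: S'_def)
          have "term_size m0 D = m0 (D, j) + (\<Sum>j\<in>{..<length D} - {j}. m0 (D, j))"
            unfolding term_size_def using j by (subst sum.remove[of _ j]) auto
          moreover have "term_size m D = m0 (D, j) - 1 + (\<Sum>j\<in>{..<length D} - {j}. m0 (D, j))"
            unfolding term_size_def using j m0 by (subst sum.remove[of _ j]) (auto simp: dec_def)
          ultimately have "term_size m D = term_size m0 D - 1" using m0 by simp
          moreover have "term_size m D' = term_size m0 D'" if "D' \<noteq> D"
            using that m0(3) by (simp add: term_size_def dec_def)
          ultimately show ?case using Suc.prems(3)[OF m0(1), of D'] 3 by (cases "D' = D") auto
        next
          case (4 m)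
          then show ?case
            using displacement_decrement[of "slots A" "(D, j)"] fin slot Suc.prems(4)
            by (auto simp: S'_def dec_def)
        next
          case (5 m)
          then obtain m0 where m0: "m0 \<in> S" "m0 (D, j) > 0" "m = dec j m0" by (auto simp: S'_def)
          have "(\<Sum>i\<in>slots A. m0 i) = m0 (D, j) + (\<Sum>i\<in>slots A - {(D, j)}. m0 i)"
            using fin slot by (subst sum.remove[of _ "(D, j)"]) auto
          moreover have "(\<Sum>i\<in>slots A. m i) = m0 (D, j) - 1 + (\<Sum>i\<in>slots A - {(D, j)}. m0 i)"
            using fin slot m0 by (subst sum.remove[of _ "(D, j)"]) (auto simp: dec_def)
          ultimately show ?case using Suc.prems(5)[OF m0(1)] m0(2) by simp
        qed
        finally show "(\<Sum>m\<in>S' j. arrangements A (dec j m)) \<le> real (F (x - D ! j))" .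
      qed
      also have "\<dots> \<le> real (F x)"
        using super[OF D, of x] by (simp flip: of_nat_sum)
      finally show ?thesis .
    qed
  qed
qed

subsection \<open>Reachable vectors and rounding\<close>

lemma real_vec_0 [simp]: "real_vec 0 = 0"
  by (simp add: real_vec_def vec_eq_iff)

lemma real_vec_add: "real_vec (x + y) = real_vec x + real_vec y"
  by (simp add: real_vec_def vec_eq_iff)

lemma real_vec_uminus: "real_vec (- x) = - real_vec x"
  by (simp add: real_vec_def vec_eq_iff)

lemma real_vec_diff: "real_vec (x - y) = real_vec x - real_vec y"
  by (simp add: real_vec_def vec_eq_iff)

lemma real_vec_smult: "real_vec (a *s x) = real_of_int a *\<^sub>R real_vec x"
  by (simp add: real_vec_def vec_eq_iff)

lemma real_vec_displacement:
  "real_vec (displacement I z) = (\<Sum>i\<in>I. real_of_int (z i) *\<^sub>R real_vec (fst i ! snd i))"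
  by (simp add: displacement_def real_vec_def vec_eq_iff)

lemma displacement_add: "displacement I (\<lambda>i. y i + z i) = displacement I y + displacement I z"
  by (simp add: displacement_def vec_eq_iff sum.distrib algebra_simps)

lemma displacement_diff: "displacement I (\<lambda>i. y i - z i) = displacement I y - displacement I z"
  by (simp add: displacement_def vec_eq_iff sum_subtractf algebra_simps)

lemma reachable_0 [simp]: "reachable terms 0"
  unfolding reachable_def by (rule exI[of _ "[]"]) simp

lemma reachable_add:
  assumes "reachable terms x" "reachable terms y"
  shows "reachable terms (x + y)"
proof -
  obtain xs where "set xs \<subseteq> (\<Union>D\<in>set terms. set D)" "x = sum_list xs"
    using assms(1) unfolding reachable_def by blast
  moreover obtain ys where "set ys \<subseteq> (\<Union>D\<in>set terms. set D)" "y = sum_list ys"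
    using assms(2) unfolding reachable_def by blast
  ultimately show ?thesis
    unfolding reachable_def by (intro exI[of _ "xs @ ys"]) auto
qed

lemma reachable_step:
  assumes "D \<in> set terms" "\<delta> \<in> set D"
  shows "reachable terms \<delta>"
  unfolding reachable_def using assms by (intro exI[of _ "[\<delta>]"]) auto

lemma reachable_sum:
  assumes "finite I" "\<And>i. i \<in> I \<Longrightarrow> reachable terms (f i)"
  shows "reachable terms (\<Sum>i\<in>I. f i)"
  using assms by (induction I rule: finite_induct) (auto intro: reachable_add)

lemma reachable_displacement:
  assumes nonneg: "\<And>i. i \<in> slots (set terms) \<Longrightarrow> z i \<ge> 0"
  shows "reachable terms (displacement (slots (set terms)) z)"
proof -
  have mult: "reachable terms (int n *s x)" if "reachable terms x" for n and x :: "int ^ 'a"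
  proof (induction n)
    case (Suc n)
    have "int (Suc n) *s x = x + int n *s x" by (simp add: vec_eq_iff algebra_simps)
    with Suc that show ?case by (simp add: reachable_add)
  qed simp
  have "reachable terms (z i *s (fst i ! snd i))" if i: "i \<in> slots (set terms)" for i
  proof -
    have "reachable terms (fst i ! snd i)"
      using i by (auto simp: slots_def intro: reachable_step)
    from mult[OF this, of "nat (z i)"] nonneg[OF i] show ?thesis by simp
  qed
  then show ?thesis
    unfolding displacement_def by (intro reachable_sum) auto
qed

lemma reachable_imp_displacement:
  assumes "reachable terms x"
  shows "\<exists>z. (\<forall>i. z i \<ge> 0) \<and> x = displacement (slots (set terms)) z"
proof -
  obtain xs where xs: "set xs \<subseteq> (\<Union>D\<in>set terms. set D)" "x = sum_list xs"
    using assms unfolding reachable_def by blast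
  have "\<exists>z. (\<forall>i. z i \<ge> 0) \<and> sum_list xs = displacement (slots (set terms)) z"
    using xs(1)
  proof (induction xs)
    case Nil
    show ?case by (intro exI[of _ "\<lambda>_. 0"]) (simp add: displacement_def)
  next
    case (Cons \<delta> xs)
    then obtain z where z: "\<forall>i. z i \<ge> 0" "sum_list xs = displacement (slots (set terms)) z" by auto
    from Cons.prems obtain D j where D: "D \<in> set terms" "j < length D" "D ! j = \<delta>"
      by (auto simp: in_set_conv_nth)
    have "displacement (slots (set terms)) (\<lambda>i. if i = (D, j) then 1 else 0) = \<delta>"
      unfolding displacement_def using D
      by (subst sum.remove[of _ "(D, j)"]) (auto simp: slots_def intro!: sum.neutral)
    with z have "sum_list (\<delta> # xs) = displacement (slots (set terms)) (\<lambda>i. (if i = (D, j) then 1 else 0) + z i)"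
      by (simp add: displacement_add)
    with z(1) show ?case by (intro exI[of _ "\<lambda>i. (if i = (D, j) then 1 else 0) + z i"]) auto
  qed
  with xs(2) show ?thesis by simp
qed

context
  fixes terms :: "(int ^ 'd) list list" and F :: "int ^ 'd \<Rightarrow> nat" and v0 :: "real ^ 'd"
  assumes F_rec: "satisfies_recurrence terms F"
    and pos: "\<forall>D\<in>set terms. \<forall>\<delta>\<in>set D. v0 \<bullet> real_vec \<delta> > 0"
begin

lemma reachable_nonneg:
  assumes "reachable terms x"
  shows "v0 \<bullet> real_vec x \<ge> 0"
proof -
  obtain xs where xs: "set xs \<subseteq> (\<Union>D\<in>set terms. set D)" "x = sum_list xs"
    using assms unfolding reachable_def by blast
  have "v0 \<bullet> real_vec (sum_list xs) \<ge> 0"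
    using xs(1)
  proof (induction xs)
    case (Cons \<delta> xs)
    then have "v0 \<bullet> real_vec \<delta> > 0" using pos by auto
    with Cons show ?case by (simp add: real_vec_add inner_add_right)
  qed simp
  with xs(2) show ?thesis by simp
qed

text \<open>At a nonzero reachable \<open>x\<close> the maximum dominates every term. Elsewhere the
  left side is \<open>0\<close>: a reachable predecessor would make \<open>x\<close> reachable,
  hence \<open>x = 0\<close>, and then \<open>- \<delta>\<close> would be reachable although
  negative under \<open>v0\<close>.\<close>

lemma superharmonic:
  assumes D: "D \<in> set terms"
  shows "(\<Sum>\<delta>\<leftarrow>D. F (x - \<delta>)) \<le> F x"
proof (cases "x \<noteq> 0 \<and> reachable terms x")
  case True
  then have "F x = Max ((\<lambda>D. \<Sum>\<delta>\<leftarrow>D. F (x - \<delta>)) ` set terms)"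
    using F_rec unfolding satisfies_recurrence_def by blast
  with D show ?thesis by (simp add: Max_ge)
next
  case False
  have "F (x - \<delta>) = 0" if \<delta>: "\<delta> \<in> set D" for \<delta>
  proof -
    have "\<not> reachable terms (x - \<delta>)"
    proof
      assume r: "reachable terms (x - \<delta>)"
      from reachable_add[OF this reachable_step[OF D \<delta>]] have "x = 0" using False by simp
      moreover have "v0 \<bullet> real_vec \<delta> > 0" using pos D \<delta> by blast
      ultimately show False using reachable_nonneg[OF r] by (simp add: real_vec_uminus)
    qed
    moreover from this have "x - \<delta> \<noteq> 0" by (metis reachable_0)
    ultimately show ?thesis using F_rec unfolding satisfies_recurrence_def by blast
  qed
  then have "(\<Sum>\<delta>\<leftarrow>D. F (x - \<delta>)) = (\<Sum>\<delta>\<leftarrow>D. 0)"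
    by (intro arg_cong[of _ _ sum_list] map_cong) auto
  also have "\<dots> = 0" by simp
  finally show ?thesis by (metis le0)
qed

text \<open>Step by step, \<open>F (x - \<delta>)\<close> is one summand of a sum bounded by
  \<open>F x\<close>. This allows the corrections made outside the schedule to be discarded, and
  \<open>y = x\<close> gives positivity at reachable vectors.\<close>

lemma F_diff_le:
  assumes "reachable terms y"
  shows "F (x - y) \<le> F x"
proof -
  obtain ys where ys: "set ys \<subseteq> (\<Union>D\<in>set terms. set D)" "y = sum_list ys"
    using assms unfolding reachable_def by blast
  have "F (x - sum_list ys) \<le> F x"
    using ys(1)
  proof (induction ys arbitrary: x)
    case (Cons \<delta> ys)
    then obtain D where D: "D \<in> set terms" "\<delta> \<in> set D" by auto
    have "F (x - sum_list (\<delta> # ys)) = F ((x - \<delta>) - sum_list ys)" by (simp add: algebra_simps)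
    also have "\<dots> \<le> F (x - \<delta>)" using Cons by auto
    also have "\<dots> \<le> (\<Sum>\<delta>\<leftarrow>D. F (x - \<delta>))" using D by (intro member_le_sum_list) auto
    also have "\<dots> \<le> F x" using D by (intro superharmonic)
    finally show ?case .
  qed simp
  with ys(2) show ?thesis by simp
qed

lemma reachable_F_pos:
  assumes "reachable terms x"
  shows "F x \<ge> 1"
  using F_diff_le[OF assms, of x] F_rec by (simp add: satisfies_recurrence_def)

end

text \<open>The residues left by rounding \<open>n \<beta>\<close> down take finitely many values, so one representation per
  value suffices. This bounds the corrections without any analysis of the lattice spanned by the
  steps.\<close>

lemma rounding:
  fixes terms :: "(int ^ 'd) list list" and \<beta> :: "(int ^ 'd) list \<times> nat \<Rightarrow> real"
  defines "I \<equiv> slots (set terms)"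
  assumes t: "real_vec t = (\<Sum>i\<in>I. \<beta> i *\<^sub>R real_vec (fst i ! snd i))"
  shows finite_residues: "finite (range (\<lambda>n. int n *s t - displacement I (\<lambda>i. \<lfloor>real n * \<beta> i\<rfloor>)))"
    and bounded_correction: "\<exists>K. \<forall>n. reachable terms (int n *s t) \<longrightarrow>
      (\<exists>k. (\<forall>i\<in>I. \<bar>k i\<bar> \<le> K \<and> (\<beta> i = 0 \<longrightarrow> k i \<ge> 0)) \<and>
         int n *s t = displacement I (\<lambda>i. \<lfloor>real n * \<beta> i\<rfloor> + k i))"
proof -
  have finI [simp]: "finite I" by (simp add: I_def)
  define e where "e n = int n *s t - displacement I (\<lambda>i. \<lfloor>real n * \<beta> i\<rfloor>)" for n
  \<comment> \<open>Each coordinate of a residue is a sum of fractional parts times step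
    coordinates, hence at most \<open>b\<close> in absolute value; being integral, the residues are
    finite in number.\<close>
  define b where "b = (\<Sum>i\<in>I. \<Sum>l\<in>UNIV. \<bar>(fst i ! snd i) $ l\<bar>)"
  have bd: "\<bar>e n $ l\<bar> \<le> b" for n l
  proof -
    have "real_of_int (t $ l) = (\<Sum>i\<in>I. \<beta> i * real_of_int ((fst i ! snd i) $ l))"
      using arg_cong[OF t, of "\<lambda>x. x $ l"] by (simp add: real_vec_def)
    then have "real_of_int (e n $ l) = real n * (\<Sum>i\<in>I. \<beta> i * real_of_int ((fst i ! snd i) $ l))
      - (\<Sum>i\<in>I. \<lfloor>real n * \<beta> i\<rfloor> * real_of_int ((fst i ! snd i) $ l))"
      by (simp add: e_def displacement_def)
    also have "\<dots> = (\<Sum>i\<in>I. (real n * \<beta> i - \<lfloor>real n * \<beta> i\<rfloor>) * real_of_int ((fst i ! snd i) $ l))"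
      by (simp only: sum_distrib_left sum_subtractf [symmetric]) (simp add: left_diff_distrib mult.assoc)
    finally have el: "real_of_int (e n $ l) = (\<Sum>i\<in>I. (real n * \<beta> i - \<lfloor>real n * \<beta> i\<rfloor>) * real_of_int ((fst i ! snd i) $ l))" .
    have "\<bar>real_of_int (e n $ l)\<bar> \<le> (\<Sum>i\<in>I. \<bar>(real n * \<beta> i - \<lfloor>real n * \<beta> i\<rfloor>) * real_of_int ((fst i ! snd i) $ l)\<bar>)"
      unfolding el by (rule sum_abs)
    also have "\<dots> \<le> (\<Sum>i\<in>I. \<bar>real_of_int ((fst i ! snd i) $ l)\<bar>)"
    proof (intro sum_mono)
      fix i
      have "0 \<le> real n * \<beta> i - \<lfloor>real n * \<beta> i\<rfloor>" "real n * \<beta> i - \<lfloor>real n * \<beta> i\<rfloor> \<le> 1" by linarith+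
      then show "\<bar>(real n * \<beta> i - \<lfloor>real n * \<beta> i\<rfloor>) * real_of_int ((fst i ! snd i) $ l)\<bar> \<le> \<bar>real_of_int ((fst i ! snd i) $ l)\<bar>"
        unfolding abs_mult by (intro mult_left_le_one_le) auto
    qed
    also have "\<dots> \<le> (\<Sum>i\<in>I. \<Sum>l\<in>UNIV. \<bar>real_of_int ((fst i ! snd i) $ l)\<bar>)"
      by (intro sum_mono member_le_sum) auto
    also have "\<dots> = real_of_int b" by (simp add: b_def)
    finally show ?thesis by linarith
  qed
  have "range e \<subseteq> vec_lambda ` (UNIV \<rightarrow>\<^sub>E {-b..b})"
  proof
    fix y assume "y \<in> range e"
    then obtain n where y: "y = e n" by auto
    have "y = vec_lambda (vec_nth y)" by simp
    moreover have "vec_nth y \<in> UNIV \<rightarrow>\<^sub>E {-b..b}"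
      using bd[of n] by (auto simp: y abs_le_iff minus_le_iff)
    ultimately show "y \<in> vec_lambda ` (UNIV \<rightarrow>\<^sub>E {-b..b})" by (rule image_eqI)
  qed
  moreover have "finite (vec_lambda ` (UNIV \<rightarrow>\<^sub>E {-b..b}) :: (int ^ 'd) set)"
    by (intro finite_imageI finite_PiE) auto
  ultimately have fin: "finite (range e)" by (rule finite_subset)
  then show "finite (range (\<lambda>n. int n *s t - displacement I (\<lambda>i. \<lfloor>real n * \<beta> i\<rfloor>)))"
    by (simp add: e_def)
  define R where "R = {n. reachable terms (int n *s t)}"
  \<comment> \<open>Subtracting the floors from nonnegative multiplicities \<open>z\<close> of a
    reachable multiple represents its residue. Where \<open>\<beta> i = 0\<close> the floor is
    \<open>0\<close>, so the entry stays nonnegative.\<close>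
  have "\<exists>k. y = displacement I k \<and> (\<forall>i\<in>I. \<beta> i = 0 \<longrightarrow> k i \<ge> 0)" if y: "y \<in> e ` R" for y
  proof -
    from y obtain n where n: "reachable terms (int n *s t)" "y = e n" by (auto simp: R_def)
    obtain z where z: "\<And>i. z i \<ge> 0" "int n *s t = displacement I z"
      using reachable_imp_displacement[OF n(1)] unfolding I_def by blast
    have "y = displacement I (\<lambda>i. z i - \<lfloor>real n * \<beta> i\<rfloor>)"
      unfolding n(2) e_def displacement_diff z(2) ..
    with z(1) show ?thesis by (intro exI[of _ "\<lambda>i. z i - \<lfloor>real n * \<beta> i\<rfloor>"]) auto
  qed
  then obtain k where k: "\<And>y. y \<in> e ` R \<Longrightarrow> y = displacement I (k y)"
    "\<And>y i. y \<in> e ` R \<Longrightarrow> i \<in> I \<Longrightarrow> \<beta> i = 0 \<Longrightarrow> k y i \<ge> 0" by metis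
  have finR: "finite (e ` R)" using fin by (rule finite_subset[rotated]) auto
  show "\<exists>K. \<forall>n. reachable terms (int n *s t) \<longrightarrow>
      (\<exists>k. (\<forall>i\<in>I. \<bar>k i\<bar> \<le> K \<and> (\<beta> i = 0 \<longrightarrow> k i \<ge> 0)) \<and>
         int n *s t = displacement I (\<lambda>i. \<lfloor>real n * \<beta> i\<rfloor> + k i))"
  proof (intro exI allI impI conjI ballI)
    fix n assume "reachable terms (int n *s t)"
    then have n: "e n \<in> e ` R" by (auto simp: R_def)
    show "\<bar>k (e n) i\<bar> \<le> (\<Sum>y\<in>e ` R. \<Sum>i\<in>I. \<bar>k y i\<bar>)" if "i \<in> I" for i
    proof -
      have "\<bar>k (e n) i\<bar> \<le> (\<Sum>i\<in>I. \<bar>k (e n) i\<bar>)" using that by (intro member_le_sum) auto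
      also have "\<dots> \<le> (\<Sum>y\<in>e ` R. \<Sum>i\<in>I. \<bar>k y i\<bar>)"
        using n finR by (intro member_le_sum[of "e n" "e ` R" "\<lambda>y. \<Sum>i\<in>I. \<bar>k y i\<bar>"]) (auto intro: sum_nonneg)
      finally show ?thesis .
    qed
    show "k (e n) i \<ge> 0" if "i \<in> I" "\<beta> i = 0" for i using k(2)[OF n that] .
    show "int n *s t = displacement I (\<lambda>i. \<lfloor>real n * \<beta> i\<rfloor> + k (e n) i)"
      unfolding displacement_add using k(1)[OF n] by (simp add: e_def algebra_simps)
  qed
qed

text \<open>Infinitely many \<open>n\<close> share the rounding residue of some \<open>n0\<close>.
  For \<open>n \<ge> n0\<close> among them, \<open>(n - n0) t\<close> is a combination of steps with
  coefficients the differences of floors, which are nonnegative by monotonicity.\<close>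

lemma infinite_reachable_multiples:
  fixes terms :: "(int ^ 'd) list list"
  assumes t: "real_vec t = (\<Sum>i\<in>slots (set terms). \<beta> i *\<^sub>R real_vec (fst i ! snd i))"
    and \<beta>: "\<And>i. i \<in> slots (set terms) \<Longrightarrow> \<beta> i \<ge> 0"
  shows "infinite {n. reachable terms (int n *s t)}"
proof -
  define I where "I = slots (set terms)"
  define e where "e n = int n *s t - displacement I (\<lambda>i. \<lfloor>real n * \<beta> i\<rfloor>)" for n
  have "finite (range e)"
    using finite_residues[of t \<beta> terms] t by (simp add: e_def I_def)
  then obtain n0 where n0: "infinite {n. e n = e n0}"
    using pigeonhole_infinite[of UNIV e] by auto
  have r: "reachable terms (int (n - n0) *s t)" if n: "n \<ge> n0" "e n = e n0" for n
  proof -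
    have "int (n - n0) *s t = int n *s t - int n0 *s t"
      using n by (simp add: vec_eq_iff of_nat_diff algebra_simps)
    also have "\<dots> = displacement I (\<lambda>i. \<lfloor>real n * \<beta> i\<rfloor>) - displacement I (\<lambda>i. \<lfloor>real n0 * \<beta> i\<rfloor>)"
      using n(2) by (simp add: e_def algebra_simps)
    also have "\<dots> = displacement I (\<lambda>i. \<lfloor>real n * \<beta> i\<rfloor> - \<lfloor>real n0 * \<beta> i\<rfloor>)"
      by (simp add: displacement_diff)
    also have "reachable terms \<dots>"
      unfolding I_def using \<beta> n by (intro reachable_displacement) (auto intro!: floor_mono mult_right_mono)
    finally show ?thesis .
  qed
  have "infinite ({n. e n = e n0} - {..<n0})" using n0 by simp
  then have "infinite ((\<lambda>n. n - n0) ` ({n. e n = e n0} - {..<n0}))"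
    by (subst finite_image_iff) (auto simp: inj_on_def)
  moreover have "(\<lambda>n. n - n0) ` ({n. e n = e n0} - {..<n0}) \<subseteq> {n. reachable terms (int n *s t)}"
    using r by auto
  ultimately show ?thesis using finite_subset by blast
qed

subsection \<open>The quasiconvex program\<close>

text \<open>The sum is strictly decreasing in its base, from \<open>length D \<ge> 1\<close> at base
  \<open>1\<close> down to \<open>0\<close> at infinity. So its root is unique and at least
  \<open>1\<close>, and comparing the root with \<open>l\<close> amounts to comparing the sum at
  \<open>l\<close> with \<open>1\<close>.\<close>

lemma term_value_le_iff:
  fixes u :: "real ^ 'd"
  assumes D: "D \<noteq> []" and pos: "\<And>\<delta>. \<delta> \<in> set D \<Longrightarrow> u \<bullet> real_vec \<delta> > 0" and l: "l > 0"
  shows "term_value u D \<le> ereal l \<longleftrightarrow> (\<Sum>\<delta>\<leftarrow>D. l powr (- (u \<bullet> real_vec \<delta>))) \<le> 1"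
    and "\<exists>c\<ge>1. term_value u D = ereal c \<and> (c = 1 \<longrightarrow> length D = 1)"
proof -
  define f where "f c = (\<Sum>\<delta>\<leftarrow>D. c powr (- (u \<bullet> real_vec \<delta>)))" for c
  have f_sum: "f c = (\<Sum>j<length D. c powr (- (u \<bullet> real_vec (D ! j))))" for c
    by (simp add: f_def sum_list_sum_nth atLeast0LessThan)
  have anti: "f b < f a" if "0 < a" "a < b" for a b
    unfolding f_sum
  proof (intro sum_strict_mono)
    fix j assume "j \<in> {..<length D}"
    then have "u \<bullet> real_vec (D ! j) > 0" using pos by auto
    then show "b powr - (u \<bullet> real_vec (D ! j)) < a powr - (u \<bullet> real_vec (D ! j))"
      using that by (intro powr_less_mono2_neg) auto
  qed (use D in auto)
  have f1: "f 1 = length D" by (simp add: f_sum)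
  have "(f \<longlongrightarrow> (\<Sum>j<length D. 0)) at_top"
    unfolding f_sum using pos
    by (intro tendsto_sum tendsto_neg_powr filterlim_ident) auto
  then have "\<forall>\<^sub>F c in at_top. f c < 1" by (intro order_tendstoD(2)[of f 0]) auto
  then have "\<forall>\<^sub>F c in at_top. f c < 1 \<and> c \<ge> 1"
    using eventually_ge_at_top[of 1] by eventually_elim simp
  then obtain b where b: "f b < 1" "b \<ge> 1" by (auto simp: eventually_at_top_linorder)
  have len: "length D \<ge> 1" using D by (cases D) auto
  have "\<exists>c. 1 \<le> c \<and> c \<le> b \<and> f c = 1"
  proof (intro IVT2)
    show "\<forall>x. 1 \<le> x \<and> x \<le> b \<longrightarrow> isCont f x"
      unfolding f_sum by (auto intro!: continuous_intros)
  qed (use b f1 len in auto)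
  then obtain c where c: "1 \<le> c" "f c = 1" by blast
  have "(THE c. c > 0 \<and> r_fun u D c = 0) = c"
  proof (rule the_equality)
    fix x assume "x > 0 \<and> r_fun u D x = 0"
    then have "x > 0" "f x = f c" using c by (auto simp: r_fun_def f_def)
    with anti[of x c] anti[of c x] c show "x = c" by (cases x c rule: linorder_cases) auto
  qed (use c in \<open>auto simp: r_fun_def f_def\<close>)
  moreover have "\<not> (\<exists>\<delta>\<in>set D. u \<bullet> real_vec \<delta> \<le> 0)" using pos by (auto simp: not_le)
  ultimately have tv: "term_value u D = ereal c" by (simp add: term_value_def)
  moreover have "c = 1 \<longrightarrow> length D = 1" using c f1 by auto
  ultimately show "\<exists>c\<ge>1. term_value u D = ereal c \<and> (c = 1 \<longrightarrow> length D = 1)"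
    using c by auto
  have "c \<le> l \<longleftrightarrow> f l \<le> 1"
    using anti[of c l] anti[of l c] c l by (cases l c rule: linorder_cases) auto
  with tv show "term_value u D \<le> ereal l \<longleftrightarrow> (\<Sum>\<delta>\<leftarrow>D. l powr (- (u \<bullet> real_vec \<delta>))) \<le> 1"
    by (simp add: f_def)
qed

lemma term_value_finite_pos:
  assumes "term_value u D < \<infinity>" "\<delta> \<in> set D"
  shows "u \<bullet> real_vec \<delta> > 0"
  using assms by (auto simp: term_value_def not_le split: if_splits)

text \<open>The exponential inequality defines a closed set containing the level set, so it passes
  to the closure, where finiteness of \<open>term_value\<close> is not known.\<close>

lemma closure_level_set:
  assumes D: "D \<noteq> []" and l: "l > 0" and w: "w \<in> closure {u. term_value u D \<le> ereal l}"
  shows "(\<Sum>\<delta>\<leftarrow>D. l powr (- (w \<bullet> real_vec \<delta>))) \<le> 1"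
proof -
  have "{u. term_value u D \<le> ereal l} \<subseteq> {u. (\<Sum>\<delta>\<leftarrow>D. l powr (- (u \<bullet> real_vec \<delta>))) \<le> 1}"
  proof safe
    fix u assume u: "term_value u D \<le> ereal l"
    then have "term_value u D < \<infinity>" by (rule order.strict_trans1) simp
    then have "u \<bullet> real_vec \<delta> > 0" if "\<delta> \<in> set D" for \<delta>
      using that by (rule term_value_finite_pos)
    from term_value_le_iff(1)[OF D this l] u
    show "(\<Sum>\<delta>\<leftarrow>D. l powr (- (u \<bullet> real_vec \<delta>))) \<le> 1" by (rule iffD1)
  qed
  moreover have "closed {u. (\<Sum>\<delta>\<leftarrow>D. l powr (- (u \<bullet> real_vec \<delta>))) \<le> 1}"
  proof -
    have "closed {u. (\<Sum>j<length D. l powr (- (u \<bullet> real_vec (D ! j)))) \<le> 1}"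
      using l by (intro closed_Collect_le continuous_intros) auto
    then show ?thesis by (simp add: sum_list_sum_nth atLeast0LessThan)
  qed
  ultimately have "closure {u. term_value u D \<le> ereal l} \<subseteq> {u. (\<Sum>\<delta>\<leftarrow>D. l powr (- (u \<bullet> real_vec \<delta>))) \<le> 1}"
    by (rule closure_minimal)
  with w show ?thesis by blast
qed

text \<open>With \<open>x = ln \<lambda> *\<^sub>R v\<close> the quasiconvex program becomes the convex program of minimising
  \<open>x \<bullet> t\<close> subject to \<open>(\<Sum>\<delta>\<leftarrow>D. exp (- (x \<bullet> \<delta>))) \<le> 1\<close> for every term \<open>D\<close>.\<close>

lemma optimal_solution_kkt:
  fixes terms :: "(int ^ 'd::{finite,linorder}) list list" and c :: real
  assumes nonempty: "\<forall>D\<in>set terms. D \<noteq> []"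
    and opt: "optimal_solution terms t c w" and c: "c > 1"
    and v0: "\<forall>D\<in>set terms. \<forall>\<delta>\<in>set D. v0 \<bullet> real_vec \<delta> > 0"
  shows "\<exists>A \<alpha>. A \<subseteq> set terms \<and> A \<noteq> {} \<and>
    (\<forall>D\<in>A. \<alpha> D > 0 \<and> (\<Sum>j<length D. exp (- ((ln c *\<^sub>R w) \<bullet> real_vec (D ! j)))) = 1) \<and>
    real_vec t = (\<Sum>D\<in>A. \<alpha> D *\<^sub>R (\<Sum>j<length D. exp (- ((ln c *\<^sub>R w) \<bullet> real_vec (D ! j))) *\<^sub>R real_vec (D ! j)))"
proof (rule kkt_multipliers)
  show "finite (set terms)" by simp
  show "1 \<le> length D" if "D \<in> set terms" for D using nonempty that by (cases D) auto
  show "0 < v0 \<bullet> real_vec (D ! j)" if "D \<in> set terms" "j < length D" for D j using v0 that by auto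
  have feas: "feasible terms t c w" and
    least: "\<And>l v. feasible terms t l v \<Longrightarrow> c \<le> l"
    using opt unfolding optimal_solution_def by force+
  have wt: "w \<bullet> real_vec t = 1" using feas by (simp add: feasible_def)
  show "(\<Sum>j<length D. exp (- ((ln c *\<^sub>R w) \<bullet> real_vec (D ! j)))) \<le> 1" if D: "D \<in> set terms" for D
  proof -
    have "(\<Sum>\<delta>\<leftarrow>D. c powr (- (w \<bullet> real_vec \<delta>))) \<le> 1"
      using feas D nonempty c by (intro closure_level_set) (auto simp: feasible_def)
    then show ?thesis
      using c by (simp add: sum_list_sum_nth atLeast0LessThan powr_def mult.commute)
  qed
  show "0 < (ln c *\<^sub>R w) \<bullet> real_vec t" using c wt by simp
  fix x assume lt: "\<And>D. D \<in> set terms \<Longrightarrow> (\<Sum>j<length D. exp (- (x \<bullet> real_vec (D ! j)))) < 1"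
    and xt: "0 < x \<bullet> real_vec t"
  \<comment> \<open>The substitution is inverted: the level is \<open>exp s\<close>, and dividing
    \<open>x\<close> by \<open>s\<close> normalises \<open>v \<bullet> t\<close> to
    \<open>1\<close>.\<close>
  define s where "s = x \<bullet> real_vec t"
  define v where "v = (1 / s) *\<^sub>R x"
  have s: "s > 0" using xt by (simp add: s_def)
  have "feasible terms t (exp s) v"
    unfolding feasible_def
  proof (intro conjI ballI)
    show "v \<bullet> real_vec t = 1" using s by (simp add: v_def s_def)
    fix D assume D: "D \<in> set terms"
    have vpos: "v \<bullet> real_vec \<delta> > 0" if \<delta>: "\<delta> \<in> set D" for \<delta>
    proof -
      obtain j where j: "j < length D" "D ! j = \<delta>" using \<delta> by (auto simp: in_set_conv_nth)
      have "exp (- (x \<bullet> real_vec (D ! j))) \<le> (\<Sum>j<length D. exp (- (x \<bullet> real_vec (D ! j))))"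
        using j by (intro member_le_sum) auto
      also note lt[OF D]
      finally have "exp (- (x \<bullet> real_vec (D ! j))) < 1" .
      then show ?thesis using j s by (simp add: v_def)
    qed
    have "(\<Sum>\<delta>\<leftarrow>D. exp s powr (- (v \<bullet> real_vec \<delta>))) = (\<Sum>j<length D. exp (- (x \<bullet> real_vec (D ! j))))"
      using s by (simp add: sum_list_sum_nth atLeast0LessThan powr_def v_def)
    with lt[OF D] have "term_value v D \<le> ereal (exp s)"
      using nonempty D vpos by (subst term_value_le_iff(1)) auto
    then show "v \<in> closure {u. term_value u D \<le> ereal (exp s)}"
      by (intro subsetD[OF closure_subset]) simp
  qed
  from least[OF this] have "ln c \<le> s" using c by (metis exp_gt_zero less_trans ln_exp ln_le_cancel_iff zero_less_one)
  then show "(ln c *\<^sub>R w) \<bullet> real_vec t \<le> x \<bullet> real_vec t" using wt by (simp add: s_def)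
qed

text \<open>A finite infimum yields a vector of finite value on every term, hence strictly positive
  on every step. All term values are at least \<open>1\<close>, and so is their infimum.\<close>

lemma optimal_solution_slater:
  fixes terms :: "(int ^ 'd::{finite,linorder}) list list" and c :: real
  assumes nonempty: "\<forall>D\<in>set terms. D \<noteq> []"
    and opt: "optimal_solution terms t c w"
    and c_inf: "ereal c = (INF v\<in>{v. v \<bullet> real_vec t = 1}. weight_value terms v)"
  shows "\<exists>v0. \<forall>D\<in>set terms. \<forall>\<delta>\<in>set D. v0 \<bullet> real_vec \<delta> > 0" and "c \<ge> 1"
proof -
  \<comment> \<open>Without terms every level \<open>l\<close> would be feasible, and there would be
    no least one.\<close>
  have ne: "terms \<noteq> []"
  proof
    assume "terms = []"
    then have "feasible terms t (c - 1) w"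
      using opt by (simp add: optimal_solution_def feasible_def)
    then show False using opt unfolding optimal_solution_def by force
  qed
  have "(INF v\<in>{v. v \<bullet> real_vec t = 1}. weight_value terms v) < \<infinity>"
    by (simp flip: c_inf)
  then obtain v where v: "weight_value terms v < \<infinity>" unfolding INF_less_iff by blast
  have tv: "term_value v D \<le> weight_value terms v" if "D \<in> set terms" for D v
    unfolding weight_value_def using that by (intro Max_ge) auto
  show "\<exists>v0. \<forall>D\<in>set terms. \<forall>\<delta>\<in>set D. v0 \<bullet> real_vec \<delta> > 0"
    using v tv[of _ v] term_value_finite_pos by (metis order_le_less_trans)
  obtain D where D: "D \<in> set terms" using ne by (cases terms) auto
  have "1 \<le> weight_value terms v" for v
  proof (cases "term_value v D < \<infinity>")
    case True
    have "1 \<le> term_value v D"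
      using term_value_le_iff(2)[of D v 1] nonempty D term_value_finite_pos[OF True] by (auto simp: one_ereal_def)
    with tv[OF D, of v] show ?thesis by simp
  next
    case False
    with tv[OF D, of v] show ?thesis by (simp add: not_less top.extremum_unique) 
  qed
  then have "1 \<le> (INF v\<in>{v. v \<bullet> real_vec t = 1}. weight_value terms v)"
    by (intro INF_greatest)
  then show "c \<ge> 1" by (simp flip: c_inf)
qed

subsection \<open>Lattice points in a box\<close>

lemma card_fibre_ge_average:
  assumes X: "finite X" and Y: "finite Y" "f ` X \<subseteq> Y" "Y \<noteq> {}"
  shows "\<exists>y\<in>Y. real (card X) / real (card Y) \<le> real (card {x \<in> X. f x = y})"
proof (rule ccontr)
  assume "\<not> ?thesis"
  then have lt: "real (card {x \<in> X. f x = y}) < real (card X) / real (card Y)" if "y \<in> Y" for y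
    using that by (auto simp: not_le)
  have "X = (\<Union>y\<in>Y. {x \<in> X. f x = y})" using Y by auto
  then have "card X \<le> (\<Sum>y\<in>Y. card {x \<in> X. f x = y})"
    using card_UN_le[OF Y(1), of "\<lambda>y. {x \<in> X. f x = y}"] by simp
  then have "real (card X) \<le> (\<Sum>y\<in>Y. real (card {x \<in> X. f x = y}))"
    by (simp flip: of_nat_sum)
  also have "\<dots> < (\<Sum>y\<in>Y. real (card X) / real (card Y))"
    using Y lt by (intro sum_strict_mono) auto
  also have "\<dots> = real (card X)" using Y by simp
  finally show False by simp
qed

text \<open>On the box of multiplicities \<open>0..L\<close>, each of the \<open>card A - 1\<close>
  term sizes and each coordinate of the displacement takes of the order of \<open>L\<close> values
  at most. Some fibre of these data is therefore large, and differences within it are relations.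
  Leaving the size of \<open>E\<close> free saves one factor of order \<open>L\<close>.\<close>

lemma many_relations:
  fixes A :: "(int ^ 'd) list set"
  assumes fin: "finite A" and E: "E \<in> A"
  shows "\<exists>M>0. \<forall>L. \<exists>Z. finite Z \<and>
    (\<forall>z\<in>Z. (\<forall>i\<in>slots A. \<bar>z i\<bar> \<le> int L) \<and> (\<forall>i. i \<notin> slots A \<longrightarrow> z i = 0) \<and>
       (\<forall>D\<in>A - {E}. (\<Sum>j<length D. z (D, j)) = 0) \<and> displacement (slots A) z = 0) \<and>
    real (L + 1) ^ card (slots A) / (M * real (L + 1)) ^ (card A - 1 + CARD('d)) \<le> real (card Z)"
proof -
  define I where "I = slots A"
  have finI [simp]: "finite I" using fin by (simp add: I_def)
  \<comment> \<open>On the box, \<open>b * L\<close> bounds the displacement coordinates in absolute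
    value and \<open>a * L\<close> the term sizes; \<open>M * (L + 1)\<close> is at least the number
    of values of either kind.\<close>
  define b where "b = (\<Sum>i\<in>I. \<Sum>l\<in>UNIV. \<bar>(fst i ! snd i) $ l\<bar>)"
  have b0: "b \<ge> 0" by (simp add: b_def sum_nonneg)
  define a where "a = int (\<Sum>D\<in>A. length D)"
  have a0: "a \<ge> 0" by (simp add: a_def sum_nonneg)
  define M where "M = real_of_int (1 + a + 2 * b)"
  have M0: "M > 0" using b0 a0 by (simp add: M_def)
  moreover have "\<exists>Z. finite Z \<and>
    (\<forall>z\<in>Z. (\<forall>i\<in>I. \<bar>z i\<bar> \<le> int L) \<and> (\<forall>i. i \<notin> I \<longrightarrow> z i = 0) \<and>
       (\<forall>D\<in>A - {E}. (\<Sum>j<length D. z (D, j)) = 0) \<and> displacement I z = 0) \<and>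
    real (L + 1) ^ card I / (M * real (L + 1)) ^ (card A - 1 + CARD('d)) \<le> real (card Z)" for L
  proof -
    define X where "X = I \<rightarrow>\<^sub>E {0..int L}"
    define Y where "Y = ((A - {E}) \<rightarrow>\<^sub>E {0..a * int L}) \<times> ((UNIV :: 'd set) \<rightarrow>\<^sub>E {- (b * int L)..b * int L})"
    define f where "f x = (restrict (\<lambda>D. \<Sum>j<length D. x (D, j)) (A - {E}), vec_nth (displacement I x))"
      for x :: "(int ^ 'd) list \<times> nat \<Rightarrow> int"
    have finX: "finite X" unfolding X_def by (intro finite_PiE) auto
    have finY: "finite Y" unfolding Y_def using fin by (intro finite_cartesian_product finite_PiE) auto
    have cardX: "real (card X) = real (L + 1) ^ card I"
      unfolding X_def by (subst card_PiE) (auto simp: algebra_simps)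
    have fXY: "f ` X \<subseteq> Y"
    proof (rule image_subsetI)
      fix x assume x: "x \<in> X"
      have x_bd: "0 \<le> x i \<and> x i \<le> int L" if "i \<in> I" for i
        using x that by (auto simp: X_def PiE_iff)
      have "(\<Sum>j<length D. x (D, j)) \<in> {0..a * int L}" if D: "D \<in> A" for D
      proof -
        have "(\<Sum>j<length D. x (D, j)) \<le> (\<Sum>j<length D. int L)"
          using x_bd D by (intro sum_mono) (auto simp: I_def slots_def)
        also have "\<dots> = int (length D) * int L" by simp
        also have "\<dots> \<le> a * int L"
          unfolding a_def using fin D by (intro mult_right_mono zle_int[THEN iffD2] member_le_sum) auto
        finally have "(\<Sum>j<length D. x (D, j)) \<le> a * int L" .
        moreover have "0 \<le> (\<Sum>j<length D. x (D, j))"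
          using x_bd D by (intro sum_nonneg) (auto simp: I_def slots_def)
        ultimately show ?thesis by simp
      qed
      moreover have "displacement I x $ l \<in> {- (b * int L)..b * int L}" for l
      proof -
        have "\<bar>displacement I x $ l\<bar> \<le> (\<Sum>i\<in>I. \<bar>x i * (fst i ! snd i) $ l\<bar>)"
          unfolding displacement_def by (simp add: sum_abs)
        also have "\<dots> \<le> (\<Sum>i\<in>I. int L * (\<Sum>l\<in>UNIV. \<bar>(fst i ! snd i) $ l\<bar>))"
          unfolding abs_mult using x_bd by (intro sum_mono mult_mono member_le_sum) auto
        also have "\<dots> = b * int L" by (simp add: b_def mult.commute flip: sum_distrib_left)
        finally show ?thesis by (simp add: abs_le_iff)
      qed
      ultimately show "f x \<in> Y" by (simp add: f_def Y_def PiE_UNIV_domain Pi_iff)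
    qed
    have "Y \<noteq> {}"
      using b0 a0 by (auto simp: Y_def PiE_eq_empty_iff)
    from card_fibre_ge_average[OF finX finY fXY this] obtain y where y: "y \<in> Y"
      "real (card X) / real (card Y) \<le> real (card {x \<in> X. f x = y})" by blast
    define \<Phi> where "\<Phi> = {x \<in> X. f x = y}"
    have cardY: "real (card Y) \<le> (M * real (L + 1)) ^ (card A - 1 + CARD('d))"
    proof -
      have "real (card Y) = real (card {0..a * int L}) ^ card (A - {E}) * real (card {- (b * int L)..b * int L}) ^ CARD('d)"
        unfolding Y_def using fin by (simp add: card_cartesian_product card_PiE)
      also have "\<dots> \<le> (M * real (L + 1)) ^ card (A - {E}) * (M * real (L + 1)) ^ CARD('d)"
      proof (intro mult_mono power_mono)
        have "real (card {0..a * int L}) = a * real L + 1"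
          using a0 by (simp add: of_nat_nat)
        also have "\<dots> \<le> M * real (L + 1)"
          using a0 b0 by (simp add: M_def algebra_simps)
        finally show "real (card {0..a * int L}) \<le> M * real (L + 1)" .
        have "real (card {- (b * int L)..b * int L}) = 2 * b * real L + 1"
          using b0 by (simp add: of_nat_nat)
        also have "\<dots> \<le> M * real (L + 1)"
          using a0 b0 by (simp add: M_def algebra_simps)
        finally show "real (card {- (b * int L)..b * int L}) \<le> M * real (L + 1)" .
      qed (use M0 in auto)
      also have "\<dots> = (M * real (L + 1)) ^ (card A - 1 + CARD('d))"
        using fin E by (simp add: power_add)
      finally show ?thesis .
    qed
    have "card Y > 0" using finY \<open>Y \<noteq> {}\<close> by (simp add: card_gt_0_iff)
    then have "real (L + 1) ^ card I / (M * real (L + 1)) ^ (card A - 1 + CARD('d)) \<le> real (card X) / real (card Y)"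
      unfolding cardX using cardY M0 by (intro divide_left_mono) auto
    also have "\<dots> \<le> real (card \<Phi>)" using y(2) by (simp add: \<Phi>_def)
    finally have card: "real (L + 1) ^ card I / (M * real (L + 1)) ^ (card A - 1 + CARD('d)) \<le> real (card \<Phi>)" .
    moreover have "real (L + 1) ^ card I / (M * real (L + 1)) ^ (card A - 1 + CARD('d)) > 0"
      using M0 by simp
    ultimately have "card \<Phi> > 0" by linarith
    then obtain g where g: "g \<in> \<Phi>" by (auto simp: card_gt_0_iff)
    \<comment> \<open>Subtracting a fixed element \<open>g\<close> of the fibre is injective and
      cancels the common term sizes and displacement; entries in \<open>0..L\<close> become entries
      between \<open>- L\<close> and \<open>L\<close>.\<close>
    define h where "h x i = (if i \<in> I then x i - g i else 0)" for x and i :: "(int ^ 'd) list \<times> nat"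
    have bd: "0 \<le> x i \<and> x i \<le> int L" if "i \<in> I" "x \<in> \<Phi>" for i x
      using that by (auto simp: \<Phi>_def X_def PiE_iff)
    have inj: "inj_on h \<Phi>"
    proof (rule inj_onI)
      fix x x' assume xx: "x \<in> \<Phi>" "x' \<in> \<Phi>" "h x = h x'"
      have "x i = x' i" if "i \<in> I" for i using fun_cong[OF xx(3), of i] that by (simp add: h_def)
      with xx show "x = x'" by (intro PiE_ext[of x I _ x']) (auto simp: \<Phi>_def X_def)
    qed
    show ?thesis
    proof (intro exI[of _ "h ` \<Phi>"] conjI ballI)
      show "finite (h ` \<Phi>)" using finX by (simp add: \<Phi>_def)
      show "real (L + 1) ^ card I / (M * real (L + 1)) ^ (card A - 1 + CARD('d)) \<le> real (card (h ` \<Phi>))"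
        using card by (simp add: card_image[OF inj])
      fix z assume "z \<in> h ` \<Phi>"
      then obtain x where x: "x \<in> \<Phi>" "z = h x" by blast
      have fx: "f x = f g" using x g by (simp add: \<Phi>_def)
      show "\<bar>z i\<bar> \<le> int L" if "i \<in> I" for i
        using bd[OF that x(1)] bd[OF that g] that by (simp add: x(2) h_def abs_le_iff)
      show "\<forall>i. i \<notin> I \<longrightarrow> z i = 0" by (simp add: x(2) h_def)
      show "(\<Sum>j<length D. z (D, j)) = 0" if D: "D \<in> A - {E}" for D
      proof -
        have "(\<Sum>j<length D. z (D, j)) = (\<Sum>j<length D. x (D, j)) - (\<Sum>j<length D. g (D, j))"
          using D by (simp add: x(2) h_def I_def slots_def sum_subtractf)
        also have "\<dots> = 0" using fun_cong[OF arg_cong[OF fx, of fst], of D] D by (simp add: f_def)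
        finally show ?thesis .
      qed
      have "displacement I z = displacement I x - displacement I g"
        unfolding displacement_diff[symmetric] by (simp add: displacement_def x(2) h_def)
      also have "\<dots> = 0" using fx by (simp add: f_def vec_nth_inject)
      finally show "displacement I z = 0" .
    qed
  qed
  ultimately show ?thesis unfolding I_def by blast
qed

subsection \<open>Growth along a drift\<close>

text \<open>The single-term bounds are multiplied over \<open>A\<close>; the exponents
  \<open>(length D - 1) / 2\<close> add up to half the number of slots minus the number of
  terms.\<close>

lemma arrangements_weight_lower:
  fixes A :: "'a list set" and p :: "'a list \<times> nat \<Rightarrow> real" and \<alpha> :: "'a list \<Rightarrow> real"
  assumes fin: "finite A" and ne: "\<And>D. D \<in> A \<Longrightarrow> D \<noteq> []"
    and p: "\<And>i. i \<in> slots A \<Longrightarrow> p i > 0" and p1: "\<And>D. D \<in> A \<Longrightarrow> (\<Sum>j<length D. p (D, j)) = 1"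
    and \<alpha>: "\<And>D. D \<in> A \<Longrightarrow> \<alpha> D > 0" and C: "C \<ge> 0"
  shows "\<exists>\<kappa>>0. \<forall>n\<ge>1. \<forall>m.
    (\<forall>i\<in>slots A. m i \<ge> 1 \<and> \<bar>real (m i) - real n * (\<alpha> (fst i) * p i)\<bar> \<le> C * sqrt (real n)) \<longrightarrow>
    \<kappa> * real n powr (- ((real (card (slots A)) - real (card A)) / 2))
      \<le> arrangements A m * (\<Prod>i\<in>slots A. p i ^ m i)"
proof -
  define Q where "Q D \<kappa> \<longleftrightarrow> \<kappa> > 0 \<and> (\<forall>n\<ge>1. \<forall>m.
      (\<forall>j<length D. m j \<ge> 1 \<and> \<bar>real (m j) - real n * \<alpha> D * p (D, j)\<bar> \<le> C * sqrt (real n))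
    \<longrightarrow> \<kappa> * real n powr (- ((real (length D) - 1) / 2))
        \<le> fact (\<Sum>j<length D. m j) / (\<Prod>j<length D. fact (m j)) * (\<Prod>j<length D. p (D, j) ^ m j))"
    for D \<kappa>
  have "\<exists>\<kappa>. Q D \<kappa>" if D: "D \<in> A" for D
    unfolding Q_def using ne[OF D] p D p1[OF D] \<alpha>[OF D] C
    by (intro multinomial_weight_lower) (auto simp: Suc_le_eq slots_def)
  then obtain \<kappa> where Q: "\<And>D. D \<in> A \<Longrightarrow> Q D (\<kappa> D)" by metis
  have \<kappa>: "\<kappa> D > 0" if "D \<in> A" for D using Q[OF that] by (simp add: Q_def)
  show ?thesis
  proof (intro exI[of _ "\<Prod>D\<in>A. \<kappa> D"] conjI allI impI)
    show "(\<Prod>D\<in>A. \<kappa> D) > 0" using \<kappa> by (intro prod_pos) auto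
    fix n m
    assume n: "n \<ge> (1::nat)"
      and m: "\<forall>i\<in>slots A. 1 \<le> m i \<and> \<bar>real (m i) - real n * (\<alpha> (fst i) * p i)\<bar> \<le> C * sqrt (real n)"
    have "- ((real (card (slots A)) - real (card A)) / 2) = (\<Sum>D\<in>A. - ((real (length D) - 1) / 2))"
      using fin by (simp add: slots_def sum_negf sum_divide_distrib[symmetric] sum_subtractf)
    moreover have "real n powr (\<Sum>D\<in>A. - ((real (length D) - 1) / 2))
      = (\<Prod>D\<in>A. real n powr (- ((real (length D) - 1) / 2)))"
      using n fin by (intro powr_sum) auto
    ultimately have "(\<Prod>D\<in>A. \<kappa> D) * real n powr (- ((real (card (slots A)) - real (card A)) / 2))
      = (\<Prod>D\<in>A. \<kappa> D * real n powr (- ((real (length D) - 1) / 2)))"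
      by (simp only: prod.distrib)
    also have "\<dots> \<le> (\<Prod>D\<in>A. fact (term_size m D) / (\<Prod>j<length D. fact (m (D, j))) * (\<Prod>j<length D. p (D, j) ^ m (D, j)))"
    proof (intro prod_mono conjI)
      fix D assume D: "D \<in> A"
      show "0 \<le> \<kappa> D * real n powr (- ((real (length D) - 1) / 2))" using \<kappa>[OF D] by simp
      show "\<kappa> D * real n powr (- ((real (length D) - 1) / 2))
        \<le> fact (term_size m D) / (\<Prod>j<length D. fact (m (D, j))) * (\<Prod>j<length D. p (D, j) ^ m (D, j))"
        unfolding term_size_def using m D
        by (intro Q[OF D, unfolded Q_def, THEN conjunct2, rule_format, OF n])
          (simp add: slots_def mult.assoc)
    qed
    also have "\<dots> = arrangements A m * (\<Prod>i\<in>slots A. p i ^ m i)"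
      by (simp only: prod.distrib arrangements_def prod_slots[OF fin])
    finally show "(\<Prod>D\<in>A. \<kappa> D) * real n powr (- ((real (card (slots A)) - real (card A)) / 2))
      \<le> arrangements A m * (\<Prod>i\<in>slots A. p i ^ m i)" .
  qed
qed

text \<open>With exponential step probabilities, the probability of a path depends only on its total
  displacement.\<close>

lemma prod_exp_displacement:
  fixes A :: "(int ^ 'd) list set"
  assumes "finite A"
  shows "(\<Prod>i\<in>slots A. exp (- (x \<bullet> real_vec (fst i ! snd i))) ^ m i)
    = exp (- (x \<bullet> real_vec (displacement (slots A) (\<lambda>i. int (m i)))))"
proof -
  have "(\<Prod>i\<in>slots A. exp (- (x \<bullet> real_vec (fst i ! snd i))) ^ m i)
    = (\<Prod>i\<in>slots A. exp (real (m i) * (- (x \<bullet> real_vec (fst i ! snd i)))))"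
    by (simp only: exp_of_nat_mult)
  also have "\<dots> = exp (\<Sum>i\<in>slots A. real (m i) * (- (x \<bullet> real_vec (fst i ! snd i))))"
    using assms by (simp only: exp_sum finite_slots)
  also have "(\<Sum>i\<in>slots A. real (m i) * (- (x \<bullet> real_vec (fst i ! snd i))))
    = - (x \<bullet> real_vec (displacement (slots A) (\<lambda>i. int (m i))))"
    by (simp add: real_vec_displacement inner_sum_right sum_negf)
  finally show ?thesis .
qed

text \<open>Here \<open>x0\<close> turns each term of \<open>A\<close> into a probability
  distribution on its steps, and \<open>t\<close> is the mean displacement when each
  \<open>D\<close> is used \<open>\<alpha> D\<close> times. Both conclusions rest on this
  representation alone, without reference to the optimisation problem.\<close>

lemma drift:
  fixes terms :: "(int ^ 'd) list list" and F :: "int ^ 'd \<Rightarrow> nat"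
    and \<alpha> :: "(int ^ 'd) list \<Rightarrow> real" and x0 :: "real ^ 'd"
  defines "p \<equiv> \<lambda>i. exp (- (x0 \<bullet> real_vec (fst i ! snd i)))"
  assumes nonempty: "\<forall>D\<in>set terms. D \<noteq> []"
    and F_rec: "satisfies_recurrence terms F"
    and v0: "\<forall>D\<in>set terms. \<forall>\<delta>\<in>set D. v0 \<bullet> real_vec \<delta> > 0"
    and A: "A \<subseteq> set terms" "A \<noteq> {}" and \<alpha>: "\<forall>D\<in>A. \<alpha> D > 0"
    and p1: "\<forall>D\<in>A. (\<Sum>j<length D. p (D, j)) = 1"
    and t: "real_vec t = (\<Sum>D\<in>A. \<alpha> D *\<^sub>R (\<Sum>j<length D. p (D, j) *\<^sub>R real_vec (D ! j)))"
  shows drift_imp_infinite_reachable: "infinite {n. reachable terms (int n *s t)}"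
    and drift_imp_growth: "\<exists>\<gamma>>0. \<exists>n0. \<forall>n\<ge>n0. reachable terms (int n *s t) \<longrightarrow>
      \<gamma> * (exp (x0 \<bullet> real_vec t) ^ n * real n powr ((1 - real CARD('d)) / 2)) \<le> real (F (int n *s t))"
proof -
  define I where "I = slots (set terms)"
  define J where "J = slots A"
  \<comment> \<open>\<open>\<beta> i\<close> is the mean number of uses of slot \<open>i\<close> per
    unit of \<open>n\<close>. Its value \<open>0\<close> outside \<open>J\<close> is what makes the
    rounding corrections there nonnegative.\<close>
  define \<beta> where "\<beta> i = (if i \<in> J then \<alpha> (fst i) * p i else 0)" for i
  have finA: "finite A" using A by (auto intro: finite_subset)
  have finI [simp]: "finite I" and finJ [simp]: "finite J" using finA by (auto simp: I_def J_def)
  have JI: "J \<subseteq> I" using A by (auto simp: I_def J_def slots_def)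
  have ppos: "p i > 0" for i by (simp add: p_def)
  have \<beta>pos: "\<beta> i > 0" if "i \<in> J" for i
    using that \<alpha> ppos by (auto simp: \<beta>_def J_def slots_def)
  have t\<beta>: "real_vec t = (\<Sum>i\<in>I. \<beta> i *\<^sub>R real_vec (fst i ! snd i))"
  proof -
    have "(\<Sum>i\<in>I. \<beta> i *\<^sub>R real_vec (fst i ! snd i)) = (\<Sum>i\<in>J. \<beta> i *\<^sub>R real_vec (fst i ! snd i))"
      using JI by (intro sum.mono_neutral_right) (auto simp: \<beta>_def)
    also have "\<dots> = (\<Sum>i\<in>J. (\<alpha> (fst i) * p i) *\<^sub>R real_vec (fst i ! snd i))"
      by (intro sum.cong) (auto simp: \<beta>_def)
    also have "\<dots> = real_vec t"
      unfolding J_def sum_slots[OF finA] t by (simp add: scaleR_sum_right)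
    finally show ?thesis ..
  qed
  have "\<beta> i \<ge> 0" for i using \<beta>pos[of i] by (cases "i \<in> J") (auto simp: \<beta>_def)
  with t\<beta> show "infinite {n. reachable terms (int n *s t)}"
    unfolding I_def by (intro infinite_reachable_multiples)
  obtain K where K: "\<And>n. reachable terms (int n *s t) \<Longrightarrow>
      \<exists>k. (\<forall>i\<in>I. \<bar>k i\<bar> \<le> K \<and> (\<beta> i = 0 \<longrightarrow> k i \<ge> 0)) \<and>
         int n *s t = displacement I (\<lambda>i. \<lfloor>real n * \<beta> i\<rfloor> + k i)"
    using bounded_correction[OF t\<beta>[unfolded I_def]] unfolding I_def by blast
  \<comment> \<open>A multiplicity deviates from \<open>n * \<beta> i\<close> by at most
    \<open>\<bar>K\<bar>\<close> through the correction, \<open>1\<close> through the floor and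
    \<open>sqrt n\<close> through the relation, in total at most \<open>C * sqrt n\<close>.\<close>
  define C where "C = \<bar>real_of_int K\<bar> + 2"
  obtain E where E: "E \<in> A" using A by blast
  obtain \<kappa> where \<kappa>: "\<kappa> > 0" and weight: "\<forall>n\<ge>1. \<forall>m.
      (\<forall>i\<in>J. m i \<ge> 1 \<and> \<bar>real (m i) - real n * (\<alpha> (fst i) * p i)\<bar> \<le> C * sqrt (real n)) \<longrightarrow>
      \<kappa> * real n powr (- ((real (card J) - real (card A)) / 2)) \<le> arrangements A m * (\<Prod>i\<in>J. p i ^ m i)"
  proof -
    have "\<exists>\<kappa>>0. \<forall>n\<ge>1. \<forall>m.
      (\<forall>i\<in>J. m i \<ge> 1 \<and> \<bar>real (m i) - real n * (\<alpha> (fst i) * p i)\<bar> \<le> C * sqrt (real n)) \<longrightarrow>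
      \<kappa> * real n powr (- ((real (card J) - real (card A)) / 2))
        \<le> arrangements A m * (\<Prod>i\<in>J. p i ^ m i)"
      unfolding J_def using nonempty A p1 \<alpha>
      by (intro arrangements_weight_lower finA ppos) (auto simp: C_def)
    then show ?thesis by (elim exE conjE) (rule that)
  qed
  obtain M where M: "M > 0" and rel: "\<And>L. \<exists>Z. finite Z \<and>
    (\<forall>z\<in>Z. (\<forall>i\<in>J. \<bar>z i\<bar> \<le> int L) \<and> (\<forall>i. i \<notin> J \<longrightarrow> z i = 0) \<and>
       (\<forall>D\<in>A - {E}. (\<Sum>j<length D. z (D, j)) = 0) \<and> displacement J z = 0) \<and>
    real (L + 1) ^ card J / (M * real (L + 1)) ^ (card A - 1 + CARD('d)) \<le> real (card Z)"
    using many_relations[OF finA E] unfolding J_def by blast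
  \<comment> \<open>\<open>B\<close> bounds \<open>x0 \<bullet> y\<close> for the correction
    \<open>y\<close> outside \<open>J\<close>. Once \<open>sqrt n\<close> reaches \<open>R\<close>,
    all multiplicities on \<open>J\<close> are at least \<open>1\<close>. The factor
    \<open>2\<close> in \<open>\<gamma>\<close> comes from
    \<open>L + 1 \<le> 2 * sqrt n\<close>.\<close>
  define B where "B = (\<Sum>i\<in>I. \<bar>real_of_int K\<bar> * \<bar>x0 \<bullet> real_vec (fst i ! snd i)\<bar>)"
  define R where "R = (\<Sum>i\<in>J. (C + 1) / \<beta> i)"
  define e where "e = card A - 1 + CARD('d)"
  define \<gamma> where "\<gamma> = \<kappa> * exp (- B) / (2 * M) ^ e"
  have "\<gamma> * (exp (x0 \<bullet> real_vec t) ^ n * real n powr ((1 - real CARD('d)) / 2)) \<le> real (F (int n *s t))"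
    if n0: "n \<ge> max 1 (nat \<lceil>R\<^sup>2\<rceil>)" and reach: "reachable terms (int n *s t)" for n
  proof -
    have n: "n \<ge> 1" using n0 by simp
    have "R\<^sup>2 \<le> real n" using n0 by linarith
    then have sqrtR: "R \<le> sqrt n" by (rule real_le_rsqrt)
    have sqrt1: "sqrt n \<ge> 1" using n by simp
    obtain k where k: "\<And>i. i \<in> I \<Longrightarrow> \<bar>k i\<bar> \<le> K" "\<And>i. i \<in> I \<Longrightarrow> \<beta> i = 0 \<Longrightarrow> k i \<ge> 0"
      "int n *s t = displacement I (\<lambda>i. \<lfloor>real n * \<beta> i\<rfloor> + k i)"
      using K[OF reach] by blast
    define L where "L = nat \<lfloor>sqrt n\<rfloor>"
    have L: "real L \<le> sqrt n" "sqrt n \<le> real (L + 1)" "real (L + 1) \<le> 2 * sqrt n"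
      using sqrt1 unfolding L_def by linarith+
    obtain Z where finZ: "finite Z"
      and Z_all: "\<forall>z\<in>Z. (\<forall>i\<in>J. \<bar>z i\<bar> \<le> int L) \<and> (\<forall>i. i \<notin> J \<longrightarrow> z i = 0) \<and>
        (\<forall>D\<in>A - {E}. (\<Sum>j<length D. z (D, j)) = 0) \<and> displacement J z = 0"
      and cardZ: "real (L + 1) ^ card J / (M * real (L + 1)) ^ e \<le> real (card Z)"
      using rel[of L] unfolding e_def[symmetric] by (elim exE conjE) (rule that)
    have Z: "\<And>z i. z \<in> Z \<Longrightarrow> i \<in> J \<Longrightarrow> \<bar>z i\<bar> \<le> int L" "\<And>z i. z \<in> Z \<Longrightarrow> i \<notin> J \<Longrightarrow> z i = 0"
        "\<And>z D. z \<in> Z \<Longrightarrow> D \<in> A - {E} \<Longrightarrow> (\<Sum>j<length D. z (D, j)) = 0" "\<And>z. z \<in> Z \<Longrightarrow> displacement J z = 0"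
      using Z_all by blast+
    \<comment> \<open>The corrections outside \<open>J\<close> are nonnegative, so \<open>y\<close>
      is reachable and \<open>F x \<le> F (n t)\<close>, while the remaining target \<open>x\<close>
      uses only slots of \<open>A\<close>.\<close>
    define y where "y = displacement I (\<lambda>i. if i \<in> J then 0 else k i)"
    define x where "x = int n *s t - y"
    have reachy: "reachable terms y"
      unfolding y_def I_def using k(2) by (intro reachable_displacement) (auto simp: I_def \<beta>_def)
    have x: "x = displacement J (\<lambda>i. \<lfloor>real n * \<beta> i\<rfloor> + k i)"
    proof -
      have "x = displacement I (\<lambda>i. if i \<in> J then \<lfloor>real n * \<beta> i\<rfloor> + k i else 0)"
        unfolding x_def y_def k(3) displacement_diff[symmetric]
        unfolding displacement_def by (intro sum.cong) (auto simp: \<beta>_def)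
      also have "\<dots> = displacement J (\<lambda>i. \<lfloor>real n * \<beta> i\<rfloor> + k i)"
        unfolding displacement_def using JI by (intro sum.mono_neutral_cong_right) auto
      finally show ?thesis .
    qed
    \<comment> \<open>For \<open>z \<in> Z\<close> the truncation by \<open>nat\<close> changes
      nothing on \<open>J\<close>, where the entries prove to be at least \<open>1\<close>; this
      also gives injectivity of \<open>m\<close>.\<close>
    define m where "m z i = nat (if i \<in> J then \<lfloor>real n * \<beta> i\<rfloor> + k i + z i else 0)"
      for z and i :: "(int ^ 'd) list \<times> nat"
    have dev: "\<bar>real_of_int (\<lfloor>real n * \<beta> i\<rfloor> + k i + z i) - real n * \<beta> i\<bar> \<le> C * sqrt n"
      if "z \<in> Z" "i \<in> J" for z i
    proof -
      have "\<bar>real_of_int (k i)\<bar> \<le> \<bar>real_of_int K\<bar>" using k(1)[of i] that JI by fastforce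
      moreover have "\<bar>real_of_int (z i)\<bar> \<le> sqrt n"
        using Z(1)[OF that] L(1) by linarith
      moreover have "\<bar>real_of_int \<lfloor>real n * \<beta> i\<rfloor> - real n * \<beta> i\<bar> \<le> 1" by linarith
      moreover have "\<bar>real_of_int K\<bar> * 1 \<le> \<bar>real_of_int K\<bar> * sqrt n"
        using sqrt1 by (intro mult_left_mono) auto
      ultimately show ?thesis using sqrt1 unfolding C_def of_int_add distrib_right by linarith
    qed
    have large: "real n * \<beta> i - C * sqrt n \<ge> 1" if i: "i \<in> J" for i
    proof -
      have "(C + 1) / \<beta> i \<le> R"
        unfolding R_def using i \<beta>pos by (intro member_le_sum) (auto simp: C_def intro!: divide_nonneg_pos)
      with sqrtR have "(C + 1) / \<beta> i \<le> sqrt n" by simp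
      then have "C + 1 \<le> sqrt n * \<beta> i" by (simp only: pos_divide_le_eq[OF \<beta>pos[OF i]])
      then have "sqrt n * (C + 1) \<le> sqrt n * (sqrt n * \<beta> i)" by (intro mult_left_mono) auto
      also have "\<dots> = real n * \<beta> i" by (simp flip: mult.assoc)
      finally have "sqrt n * C + sqrt n \<le> real n * \<beta> i" by (simp only: distrib_left mult_1_right)
      then show ?thesis using sqrt1 unfolding mult.commute[of C] by linarith
    qed
    have int_m: "int (m z i) = \<lfloor>real n * \<beta> i\<rfloor> + k i + z i" and m1: "m z i \<ge> 1"
      if "z \<in> Z" "i \<in> J" for z i
    proof -
      have "real_of_int (\<lfloor>real n * \<beta> i\<rfloor> + k i + z i) \<ge> 1"
        using abs_le_D2[OF dev[OF that]] large[OF that(2)] by argo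
      then have ge1: "\<lfloor>real n * \<beta> i\<rfloor> + k i + z i \<ge> 1" by (simp only: of_int_1_le_iff)
      have mz: "m z i = nat (\<lfloor>real n * \<beta> i\<rfloor> + k i + z i)" using that by (simp only: m_def if_True)
      show "int (m z i) = \<lfloor>real n * \<beta> i\<rfloor> + k i + z i" unfolding mz using ge1 by (intro int_nat_eq[THEN trans]) auto
      then show "m z i \<ge> 1" using ge1 by linarith
    qed
    have inj: "inj_on m Z"
    proof (rule inj_onI, rule ext)
      fix z z' i assume z: "z \<in> Z" "z' \<in> Z" "m z = m z'"
      show "z i = z' i"
        using int_m[OF z(1), of i] int_m[OF z(2), of i] z Z(2)[OF z(1), of i] Z(2)[OF z(2), of i] by (cases "i \<in> J") auto
    qed
    have disp: "displacement J (\<lambda>i. int (m z i)) = x" if z: "z \<in> Z" for z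
    proof -
      have "displacement J (\<lambda>i. int (m z i)) = displacement J (\<lambda>i. (\<lfloor>real n * \<beta> i\<rfloor> + k i) + z i)"
        unfolding displacement_def using int_m[OF z] by (intro sum.cong) auto
      then show ?thesis using Z(4)[OF z] by (simp only: displacement_add x) simp
    qed
    have "(\<Sum>m\<in>m ` Z. arrangements A m) \<le> real (F x)"
    \<comment> \<open>Relations in \<open>Z\<close> sum to \<open>0\<close> over each term other
      than \<open>E\<close>, so the prescribed numbers of uses \<open>q\<close> are the same for all
      \<open>z\<close>.\<close>
    proof (rule sum_arrangements_le[OF finA E, where q = "\<lambda>D. nat (\<Sum>j<length D. \<lfloor>real n * \<beta> (D, j)\<rfloor> + k (D, j))"])
      show "F 0 = 1" using F_rec by (simp add: satisfies_recurrence_def)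
      show "(\<Sum>j<length D. F (x - D ! j)) \<le> F x" if "D \<in> A" for x D
      proof -
        have "(\<Sum>\<delta>\<leftarrow>D. F (x - \<delta>)) \<le> F x"
          using that A by (intro superharmonic[OF F_rec v0]) auto
        then show ?thesis by (simp add: sum_list_sum_nth atLeast0LessThan)
      qed
      show "0 < v0 \<bullet> real_vec \<delta>" if "D \<in> A" "\<delta> \<in> set D" for D \<delta> using v0 that A by auto
      show "finite (m ` Z)" using finZ by simp
      show "m' i = 0" if "m' \<in> m ` Z" "i \<notin> slots A" for m' i
        using that by (auto simp: m_def J_def)
      show "displacement (slots A) (\<lambda>i. int (m' i)) = x" if "m' \<in> m ` Z" for m'
        using that disp by (auto simp: J_def)
      show "term_size m' D = nat (\<Sum>j<length D. \<lfloor>real n * \<beta> (D, j)\<rfloor> + k (D, j))"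
        if "m' \<in> m ` Z" "D \<in> A - {E}" for m' D
      proof -
        obtain z where z: "z \<in> Z" "m' = m z" using \<open>m' \<in> m ` Z\<close> by blast
        have "int (term_size m' D) = (\<Sum>j<length D. \<lfloor>real n * \<beta> (D, j)\<rfloor> + k (D, j) + z (D, j))"
          unfolding term_size_def z(2) of_nat_sum using int_m[OF z(1)] \<open>D \<in> A - {E}\<close>
          by (intro sum.cong) (auto simp: J_def slots_def)
        also have "\<dots> = (\<Sum>j<length D. \<lfloor>real n * \<beta> (D, j)\<rfloor> + k (D, j)) + (\<Sum>j<length D. z (D, j))"
          by (simp add: sum.distrib)
        also have "\<dots> = (\<Sum>j<length D. \<lfloor>real n * \<beta> (D, j)\<rfloor> + k (D, j))"
          using Z(3)[OF z(1) \<open>D \<in> A - {E}\<close>] by simp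
        finally show ?thesis by simp
      qed
    qed
    also have "F x \<le> F (int n *s t)"
      unfolding x_def using reachy by (intro F_diff_le[OF F_rec v0])
    finally have F_ge: "(\<Sum>z\<in>Z. arrangements A (m z)) \<le> real (F (int n *s t))"
      by (simp add: sum.reindex[OF inj])
    \<comment> \<open>\<open>W\<close> is a lower bound common to all \<open>z\<close>: the bound on
      the multinomial probability divided by the path probability
      \<open>exp (- (x0 \<bullet> x))\<close>.\<close>
    define W where "W = \<kappa> * real n powr (- ((real (card J) - real (card A)) / 2)) * exp (x0 \<bullet> real_vec x)"
    have "W \<le> arrangements A (m z)" if z: "z \<in> Z" for z
    proof -
      have "\<bar>real (m z i) - real n * (\<alpha> (fst i) * p i)\<bar> \<le> C * sqrt (real n)" if i: "i \<in> J" for i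
      proof -
        have "real (m z i) = real_of_int (\<lfloor>real n * \<beta> i\<rfloor> + k i + z i)"
          using int_m[OF z i] by (metis of_int_of_nat_eq)
        with dev[OF z i] i show ?thesis by (simp add: \<beta>_def)
      qed
      then have "\<kappa> * real n powr (- ((real (card J) - real (card A)) / 2)) \<le> arrangements A (m z) * (\<Prod>i\<in>J. p i ^ m z i)"
        using weight[rule_format, OF n, of "m z"] m1[OF z] by blast
      also have "(\<Prod>i\<in>J. p i ^ m z i) = exp (- (x0 \<bullet> real_vec x))"
        unfolding p_def J_def prod_exp_displacement[OF finA] using disp[OF z] by (simp add: J_def)
      finally have "W \<le> arrangements A (m z) * exp (- (x0 \<bullet> real_vec x)) * exp (x0 \<bullet> real_vec x)"
        unfolding W_def by (rule mult_right_mono) simp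
      also have "\<dots> = arrangements A (m z)" by (simp add: exp_minus)
      finally show ?thesis .
    qed
    then have card_W: "real (card Z) * W \<le> real (F (int n *s t))"
      using sum_bounded_below[of Z W "\<lambda>z. arrangements A (m z)"] F_ge by simp
    have W_ge: "\<kappa> * real n powr (- ((real (card J) - real (card A)) / 2)) * (exp (- B) * exp (x0 \<bullet> real_vec t) ^ n) \<le> W"
    proof -
      have "x0 \<bullet> real_vec y \<le> B"
      proof -
        have "x0 \<bullet> real_vec y = (\<Sum>i\<in>I. (if i \<in> J then 0 else real_of_int (k i)) * (x0 \<bullet> real_vec (fst i ! snd i)))"
          unfolding y_def real_vec_displacement inner_sum_right by (intro sum.cong) auto
        also have "\<dots> \<le> (\<Sum>i\<in>I. \<bar>(if i \<in> J then 0 else real_of_int (k i)) * (x0 \<bullet> real_vec (fst i ! snd i))\<bar>)"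
          by (intro sum_mono) simp
        also have "\<dots> \<le> B"
          unfolding B_def abs_mult using k(1) by (intro sum_mono mult_right_mono) fastforce+
        finally show ?thesis .
      qed
      then have "exp (- B) * exp (x0 \<bullet> real_vec t) ^ n \<le> exp (x0 \<bullet> real_vec x)"
        by (simp add: x_def real_vec_diff real_vec_smult inner_diff_right flip: exp_of_nat_mult exp_add)
      then show ?thesis unfolding W_def using \<kappa> by (intro mult_left_mono) auto
    qed
    have cardZ': "real n powr (real (card J) / 2 - real e / 2) / (2 * M) ^ e \<le> real (card Z)"
    proof -
      have pw: "sqrt n ^ l = real n powr (real l / 2)" for l
        using n by (simp add: powr_half_sqrt[symmetric] powr_powr flip: powr_realpow)
      have "real n powr (real (card J) / 2 - real e / 2) / (2 * M) ^ e
        = sqrt n ^ card J / (2 * M * sqrt n) ^ e"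
        by (simp add: power_mult_distrib pw powr_diff)
      also have "\<dots> \<le> real (L + 1) ^ card J / (M * real (L + 1)) ^ e"
        using L M by (intro frac_le power_mono) (auto simp: mult.commute mult.left_commute intro!: mult_left_mono)
      finally show ?thesis using cardZ by simp
    qed
    \<comment> \<open>The slots gained by counting relations cancel those lost in the probabilities.
      Likewise \<open>card A\<close> cancels against its share of \<open>e\<close>, so that only the
      dimension remains.\<close>
    have exponent: "real (card J) / 2 - real e / 2 - (real (card J) - real (card A)) / 2 = (1 - real CARD('d)) / 2"
    proof -
      have "card A > 0" using finA E by (auto simp: card_gt_0_iff)
      then have "real e = real (card A) - 1 + real CARD('d)" by (simp add: e_def of_nat_diff)
      then show ?thesis by argo
    qed
    have powr_exponent: "real n powr ((1 - real CARD('d)) / 2)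
      = real n powr (real (card J) / 2 - real e / 2) * real n powr (- ((real (card J) - real (card A)) / 2))"
      unfolding exponent[symmetric] powr_add[symmetric] by simp
    have "\<gamma> * (exp (x0 \<bullet> real_vec t) ^ n * real n powr ((1 - real CARD('d)) / 2))
      = (real n powr (real (card J) / 2 - real e / 2) / (2 * M) ^ e) *
        (\<kappa> * real n powr (- ((real (card J) - real (card A)) / 2)) * (exp (- B) * exp (x0 \<bullet> real_vec t) ^ n))"
      unfolding powr_exponent \<gamma>_def by (simp only: divide_inverse mult_ac)
    also have "\<dots> \<le> real (card Z) * W"
      using cardZ' W_ge \<kappa> by (intro mult_mono) auto
    also have "\<dots> \<le> real (F (int n *s t))" by (rule card_W)
    finally show ?thesis .
  qed
  note growth = this
  have "\<gamma> > 0" using \<kappa> M by (simp add: \<gamma>_def)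
  then show "\<exists>\<gamma>>0. \<exists>n0. \<forall>n\<ge>n0. reachable terms (int n *s t) \<longrightarrow>
      \<gamma> * (exp (x0 \<bullet> real_vec t) ^ n * real n powr ((1 - real CARD('d)) / 2)) \<le> real (F (int n *s t))"
    by (intro exI conjI allI impI) (assumption | rule growth)+
qed

theorem theorem2:
  fixes terms :: "(int ^ 'd::{finite,linorder}) list list"
    and F :: "int ^ 'd::{finite,linorder} \<Rightarrow> nat"
    and t :: "int ^ 'd::{finite,linorder}"
    and c :: real
    and w :: "real ^ 'd::{finite,linorder}"
  assumes terms_nonempty: "\<forall>D\<in>set terms. D \<noteq> []"
    and F_rec: "satisfies_recurrence terms F"
    and opt: "optimal_solution terms t c w"
    and c_inf: "ereal c = (INF v\<in>{v. v \<bullet> real_vec t = 1}. weight_value terms v)"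
  shows "(\<lambda>n. real (F (int n *s t)))
           \<in> \<Omega>[reachable_multiples terms t](\<lambda>n. c ^ n * real n powr ((1 - real CARD('d)) / 2))
         \<and> (c > 1 \<longrightarrow> infinite {n. reachable terms (int n *s t)})"
proof -
  obtain v0 where v0: "\<forall>D\<in>set terms. \<forall>\<delta>\<in>set D. v0 \<bullet> real_vec \<delta> > 0"
    using optimal_solution_slater(1)[OF terms_nonempty opt c_inf] by (rule exE)
  have c1: "c \<ge> 1" by (rule optimal_solution_slater(2)[OF terms_nonempty opt c_inf])
  have bigomegaI: "(\<lambda>n. real (F (int n *s t)))
      \<in> \<Omega>[reachable_multiples terms t](\<lambda>n. c ^ n * real n powr ((1 - real CARD('d)) / 2))"
    if "\<gamma> > 0" "\<And>n. n \<ge> n0 \<Longrightarrow> reachable terms (int n *s t) \<Longrightarrow>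
      \<gamma> * (c ^ n * real n powr ((1 - real CARD('d)) / 2)) \<le> real (F (int n *s t))" for \<gamma> n0
    unfolding reachable_multiples_def
  proof (rule landau_omega.bigI[OF \<open>\<gamma> > 0\<close>])
    show "\<forall>\<^sub>F n in inf sequentially (principal {n. reachable terms (int n *s t)}).
      \<gamma> * norm (c ^ n * real n powr ((1 - real CARD('d)) / 2)) \<le> norm (real (F (int n *s t)))"
      unfolding eventually_inf_principal using eventually_ge_at_top[of n0]
    proof eventually_elim
      case (elim n)
      show ?case
      proof
        assume "n \<in> {n. reachable terms (int n *s t)}"
        then have "reachable terms (int n *s t)" by simp
        moreover have "norm (c ^ n * real n powr ((1 - real CARD('d)) / 2)) = c ^ n * real n powr ((1 - real CARD('d)) / 2)"
          unfolding real_norm_def using c1 by (intro abs_of_nonneg mult_nonneg_nonneg) auto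
        ultimately show "\<gamma> * norm (c ^ n * real n powr ((1 - real CARD('d)) / 2)) \<le> norm (real (F (int n *s t)))"
          using that(2)[OF elim] by (simp only: norm_of_nat)
      qed
    qed
  qed
  show ?thesis
  proof (cases "c > 1")
    case False
    with c1 have c: "c = 1" by simp
    \<comment> \<open>For \<open>c = 1\<close> the comparison function is at most \<open>1\<close>
      as \<open>d \<ge> 1\<close>, while \<open>F\<close> is at least \<open>1\<close> at reachable
      vectors.\<close>
    have "1 * (c ^ n * real n powr ((1 - real CARD('d)) / 2)) \<le> real (F (int n *s t))"
      if "n \<ge> 1" "reachable terms (int n *s t)" for n
    proof -
      have "CARD('d) \<ge> 1" by (simp add: Suc_le_eq)
      then have "real n powr ((1 - real CARD('d)) / 2) \<le> real n powr 0"
        using that(1) by (intro powr_mono) auto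
      also have "\<dots> \<le> real (F (int n *s t))"
        using reachable_F_pos[OF F_rec v0 that(2)] that(1) by simp
      finally show ?thesis by (simp add: c)
    qed
    from bigomegaI[OF zero_less_one this] False show ?thesis by blast
  next
    case True
    obtain A \<alpha> where A: "A \<subseteq> set terms" "A \<noteq> {}"
      and tight: "\<forall>D\<in>A. \<alpha> D > 0 \<and> (\<Sum>j<length D. exp (- ((ln c *\<^sub>R w) \<bullet> real_vec (D ! j)))) = 1"
      and t: "real_vec t = (\<Sum>D\<in>A. \<alpha> D *\<^sub>R (\<Sum>j<length D. exp (- ((ln c *\<^sub>R w) \<bullet> real_vec (D ! j))) *\<^sub>R real_vec (D ! j)))"
      using optimal_solution_kkt[OF terms_nonempty opt True v0] by (elim exE conjE) (rule that)
    have \<alpha>: "\<forall>D\<in>A. \<alpha> D > 0" using tight by blast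
    have p1: "\<forall>D\<in>A. (\<Sum>j<length D. exp (- ((ln c *\<^sub>R w) \<bullet> real_vec (fst (D, j) ! snd (D, j))))) = 1"
      using tight by simp
    have t': "real_vec t = (\<Sum>D\<in>A. \<alpha> D *\<^sub>R (\<Sum>j<length D.
        exp (- ((ln c *\<^sub>R w) \<bullet> real_vec (fst (D, j) ! snd (D, j)))) *\<^sub>R real_vec (D ! j)))"
      using t by simp
    have "w \<bullet> real_vec t = 1" using opt by (simp add: optimal_solution_def feasible_def)
    then have exp_c: "exp ((ln c *\<^sub>R w) \<bullet> real_vec t) = c" using True by simp
    obtain \<gamma> n0 where "\<gamma> > 0" and growth: "\<forall>n\<ge>n0. reachable terms (int n *s t) \<longrightarrow>
      \<gamma> * (c ^ n * real n powr ((1 - real CARD('d)) / 2)) \<le> real (F (int n *s t))"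
      using drift_imp_growth[OF terms_nonempty F_rec v0 A \<alpha> p1 t'] unfolding exp_c
      by (elim exE conjE) (rule that)
    \<comment> \<open>Infinitely many reachable multiples keep the filter from being trivial, so the
      asymptotic bound is not vacuous.\<close>
    from bigomegaI[OF this(1) growth[rule_format]]
      drift_imp_infinite_reachable[OF terms_nonempty F_rec v0 A \<alpha> p1 t']
    show ?thesis by (intro conjI impI)
  qed
qed

end
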